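(* Let $q$ be a prime power and let $A$ be a $3\times 3$ matrix over $\mathbb{F}_q$ such that the plane curve $C_A$ is nonsingular (equivalently, the characteristic polynomial $f_A(t)$ of $A$ is irreducible over $\mathbb{F}_q$). Then there is an element $\overline{B}_0 \in \mathrm{Aut}_{\mathbb{F}_q}(C_A)$ such that the following hold. (a) $\langle \overline{B}_0\rangle$ is a cyclic subgroup of order $q^2+q+1$ of $\mathrm{Aut}_{\mathbb{F}_q}(C_A)$, and it is normal in $\mathrm{Aut}_{\mathbb{F}_q}(C_A)$. (b) Let $\Lambda_0,\Lambda_1,\Lambda_2$ be eigenvectors of ${}^tA$ with distinct eigenvalues, and $\overline{\Lambda}_0,\overline{\Lambda}_1,\overline{\Lambda}_2$ the corresponding points of $\mathbb{P}^2$. Then for every $s$ with $1 \le s < q^2+q+1$, the set of fixed points of $\overline{B}_0^s$ is $\{\overline{\Lambda}_0,\overline{\Lambda}_1,\overline{\Lambda}_2\}$. (c) $\mathrm{Aut}_{\mathbb{F}_q}(C_A)/\langle\overline{B}_0\rangle$ is either trivial or cyclic of order $3$. (d) $\mathrm{Aut}_{\mathbb{F}_q}(C_A)/\langle\overline{B}_0\rangle$ is nontrivial if and only if either (i) $q \equiv 1 \bmod 3$ and there exists $A' \in GL(3,\mathbb{F}_q)$ with $f_{A'}(t) = t^3 - a$ (for some $a\in\mathbb{F}_q$) such that $C_A = C_{A'}$, or (ii) $q = 3^e$ and the characteristic polynomial $f_A(t)$ of $A$ is of the form $f_A(t) = t^3 - (\mu^2 t + a)$ for some $\mu \in \mathbb{F}_q^{\times}$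 (and some $a \in \mathbb{F}_q$).
   Context: $K$ is the algebraic closure of $\mathbb{F}_q$, and ${}^tM$ is the transpose of $M$. For a $3\times 3$ matrix $M$ over $\mathbb{F}_q$, $f_M(t) = \det(tE-M)$ and $C_M$ is the curve in $\mathbb{P}^2$ defined by $F_M = (x,y,z)\,M\,{}^t(y^q z - y z^q,\, z^q x - z x^q,\, x^q y - x y^q) = 0$; it is nonsingular if it has no singular $K$-point. A bar denotes the image under $GL(3,\mathbb{F}_q)\to PGL(3,\mathbb{F}_q)$. $\mathrm{Aut}_{\mathbb{F}_q}(C_A)$ is the automorphism group of $C_A$ over $\mathbb{F}_q$; every such automorphism is induced by a unique linear transformation of $\mathbb{P}^2$, so it is regarded as the subgroup of $PGL(3,\mathbb{F}_q)$ of those $\overline{B}$ with $\overline{B}(C_A) = C_A$, where $\overline{B}$ acts on points of $\mathbb{P}^2$, written as column vectors, by left multiplication by $B$. Eigenvectors are taken in $K^3$ (since $f_A$ is irreducible, ${}^tA$ has three distinct eigenvalues in $\mathbb{F}_{q^3}$) and fixed points are points of $\mathbb{P}^2(K)$. *)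

theory Defs
  imports
    "HOL-Analysis.Cartesian_Space"
    "HOL-Analysis.Determinants"
    "HOL-Algebra.Elementary_Groups"
    "HOL-Algebra.Algebraic_Closure_Type"
    "HOL-Computational_Algebra.Polynomial"
    "HOL-Number_Theory.Cong"
begin

text \<open>
  Throughout, the finite field with \<open>q\<close> elements is a type \<open>'a :: {field, finite}\<close> with
  \<open>q = CARD('a)\<close>, and its algebraic closure is \<open>'a alg_closure\<close>, with embedding \<open>to_ac\<close>.
\<close>

definition charpoly :: "'a::comm_ring_1 ^ 'n ^ 'n \<Rightarrow> 'a poly" where
  "charpoly M = det (mat [:0, 1:] - map_matrix (\<lambda>c. [:c:]) M)"

definition eigenvector :: "'a::field ^ 'n ^ 'n \<Rightarrow> 'a ^ 'n \<Rightarrow> 'a \<Rightarrow> bool" where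
  "eigenvector M v c \<longleftrightarrow> v \<noteq> 0 \<and> M *v v = c *s v"

text \<open>
  The form \<open>(x,y,z) M \<^sup>t(y\<^sup>q z - y z\<^sup>q, z\<^sup>q x - z x\<^sup>q, x\<^sup>q y - x y\<^sup>q)\<close>. It is defined for matrices and
  arguments in an arbitrary commutative ring, so that it can be evaluated both at points over the
  algebraic closure and at polynomials.
\<close>

definition plane_form :: "nat \<Rightarrow> 'r::comm_ring_1 ^ 3 ^ 3 \<Rightarrow> 'r ^ 3 \<Rightarrow> 'r" where
  "plane_form q M v =
     (let x = v $ 1; y = v $ 2; z = v $ 3;
          w = vector [y ^ q * z - y * z ^ q, z ^ q * x - z * x ^ q, x ^ q * y - x * y ^ q] :: 'r ^ 3
      in \<Sum>i\<in>UNIV. (v v* M) $ i * w $ i)"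

definition form_at :: "'a::{field,finite} ^ 3 ^ 3 \<Rightarrow> 'a alg_closure ^ 3 \<Rightarrow> 'a alg_closure" where
  "form_at M v = plane_form CARD('a) (map_matrix to_ac M) v"

text \<open>
  The formal partial derivative of the form in the \<open>i\<close>-th variable, at \<open>v\<close>: all other variables are
  specialised to the coordinates of \<open>v\<close>, the resulting univariate polynomial is differentiated
  formally and then evaluated at \<open>v $ i\<close>.
\<close>

definition form_partial ::
    "'a::{field,finite} ^ 3 ^ 3 \<Rightarrow> 3 \<Rightarrow> 'a alg_closure ^ 3 \<Rightarrow> 'a alg_closure" where
  "form_partial M i v =
     poly (pderiv (plane_form CARD('a) (map_matrix (\<lambda>c. [:to_ac c:]) M)
                     (\<chi> j. if j = i then [:0, 1:] else [:v $ j:])))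
          (v $ i)"

text \<open>Points of the projective plane are the one-dimensional subspaces.\<close>

definition proj_point :: "'k::field ^ 3 \<Rightarrow> ('k ^ 3) set" where
  "proj_point v = vec.span {v}"

definition proj_plane :: "('k::field ^ 3) set set" where
  "proj_plane = {proj_point v | v. v \<noteq> 0}"

definition curve :: "'a::{field,finite} ^ 3 ^ 3 \<Rightarrow> ('a alg_closure ^ 3) set set" where
  "curve M = {proj_point v | v. v \<noteq> 0 \<and> form_at M v = 0}"

definition singular_points :: "'a::{field,finite} ^ 3 ^ 3 \<Rightarrow> ('a alg_closure ^ 3) set set" where
  "singular_points M =
     {proj_point v | v. v \<noteq> 0 \<and> form_at M v = 0 \<and> (\<forall>i. form_partial M i v = 0)}"

definition nonsingular_curve :: "'a::{field,finite} ^ 3 ^ 3 \<Rightarrow> bool" where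
  "nonsingular_curve M \<longleftrightarrow> singular_points M = {}"

definition GL3 :: "('a::field ^ 3 ^ 3) monoid" where
  "GL3 = \<lparr>carrier = {B. invertible B}, mult = (**), one = mat 1\<rparr>"

definition PGL3 :: "('a::field ^ 3 ^ 3) set monoid" where
  "PGL3 = GL3 Mod {mat c | c. c \<noteq> 0}"

text \<open>
  An element of \<open>PGL3\<close> is a coset of matrices which differ by nonzero scalars; hence every member of
  the coset maps a given point to the same point, and the set below is that point.
\<close>

definition pgl_act ::
    "('a::{field,finite} ^ 3 ^ 3) set \<Rightarrow> ('a alg_closure ^ 3) set \<Rightarrow> ('a alg_closure ^ 3) set" where
  "pgl_act S p = {map_matrix to_ac B *v v | B v. B \<in> S \<and> v \<in> p}"

definition fixed_points :: "('a::{field,finite} ^ 3 ^ 3) set \<Rightarrow> ('a alg_closure ^ 3) set set" where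
  "fixed_points S = {p \<in> proj_plane. pgl_act S p = p}"

definition Aut_curve :: "'a::{field,finite} ^ 3 ^ 3 \<Rightarrow> ('a ^ 3 ^ 3) set monoid" where
  "Aut_curve A = PGL3\<lparr>carrier := {S \<in> carrier PGL3. pgl_act S ` curve A = curve A}\<rparr>"

end

theory Submission
  imports Defs "HOL-Algebra.Sylow" "HOL-Algebra.Multiplicative_Group"
begin

text \<open>Write \<open>T\<close> for the transpose of \<open>A\<close> and \<open>\<phi>\<close> for the map which raises all entries of a vector to the
  \<open>q\<close>-th power. The form that defines the curve is \<open>det (T v, \<phi> v, v)\<close> (\<open>form_at_triple\<close>), and the
  whole proof is linear algebra with this determinant.

  If the characteristic polynomial has a root in \<open>\<F>\<^sub>q\<close>, an eigenvector of \<open>T\<close> over \<open>\<F>\<^sub>q\<close> is a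
  singular point. Otherwise the roots are three conjugates \<open>\<lambda>, \<lambda>\<^sup>q, \<lambda>\<^bsup>q\<^sup>2\<^esup>\<close>, and \<open>A\<close> has eigenvectors
  that \<open>\<phi>\<close> permutes cyclically. Taken as the rows of a matrix \<open>P\<close>, they diagonalise \<open>T\<close>, and in the
  coordinates \<open>x = P v\<close> the Frobenius becomes \<open>x\<^sub>i \<mapsto> x\<^sub>i\<^sub>-\<^sub>1\<^sup>q\<close>. The equation of the curve turns into
  \<open>a x\<^sub>1\<^bsup>q+1\<^esup> x\<^sub>3 + b x\<^sub>2\<^bsup>q+1\<^esup> x\<^sub>1 + c x\<^sub>3\<^bsup>q+1\<^esup> x\<^sub>2 = 0\<close> with \<open>a, b, c\<close> the differences of the eigenvalues,
  and nonsingularity is read off from its partial derivatives. The locale \<open>frobenius_eigenbasis\<close> is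
  this setting.

  The same equation shows that another matrix over \<open>\<F>\<^sub>q\<close> defines the same point set as \<open>A\<close> only if
  it is \<open>m A + n E\<close> (\<open>twisted_curve_determines_matrix\<close>, \<open>curve_subset_imp_affine\<close>): for
  each value of one affine coordinate it is a separable polynomial of degree \<open>q + 1\<close> in the other
  one, so it divides the form of the other matrix, and comparing coefficients determines that matrix. Since \<open>B\<close>
  maps \<open>C\<^sub>A\<close> to the curve of the matrix with transpose \<open>B T B\<^sup>-\<^sup>1\<close>, the class of \<open>B\<close> is an automorphism
  exactly if \<open>B T B\<^sup>-\<^sup>1 = m T + n E\<close>. Such a \<open>B\<close> permutes the three eigenlines, and because it commutes
  with \<open>\<phi>\<close> the permutation is a rotation of the indices: \<open>P B P\<^sup>-\<^sup>1\<close> is monomial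
  (\<open>proj_class_in_Aut_iff\<close>).

  Sending an automorphism to its rotation is a homomorphism to the group of order three, and its
  kernel consists of the classes of the diagonal matrices \<open>diag (\<beta>, \<beta>\<^sup>q, \<beta>\<^bsup>q\<^sup>2\<^esup>)\<close> with \<open>\<beta>\<close> nonzero in
  \<open>\<F>\<^bsub>q\<^sup>3\<^esub>\<close>, that is, it is the group \<open>\<F>\<^bsub>q\<^sup>3\<^esub>\<^sup>\<times> / \<F>\<^sub>q\<^sup>\<times>\<close>. A primitive element gives the generator
  (\<open>kernel_generator\<close>); its powers outside \<open>\<F>\<^sub>q\<close> have distinct conjugates, hence fix only the
  three eigenpoints (\<open>fixed_points_eigenvectors\<close>). This proves (a), (b) and (c).

  A nontrivial rotation occurs exactly if \<open>\<lambda>\<^sup>q = m \<lambda> + n\<close> with \<open>m, n\<close> in \<open>\<F>\<^sub>q\<close>. The affine map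
  \<open>x \<mapsto> m x + n\<close> then permutes the roots cyclically, so \<open>m\<^sup>3 = 1\<close>. For \<open>m \<noteq> 1\<close> it has a fixed point,
  and moving this to the origin replaces \<open>A\<close> by a matrix with characteristic polynomial \<open>t\<^sup>3 - a\<close>; for
  \<open>m = 1\<close> it is a translation of order three, the characteristic is three and \<open>\<lambda>\<close> is a root of
  \<open>t\<^sup>3 - n\<^sup>2 t - a\<close> (\<open>affine_shift_iff\<close>). This is (d).\<close>

text \<open>The symbol \<open>$\<close> is reserved for the entries of vectors.\<close>

no_notation fps_nth (infixl \<open>$\<close> 75)

section \<open>Finite fields inside their algebraic closure\<close>

lemma CARD_finite_field_gt_1: "CARD('a::{field,finite}) > 1"
  using card_mono[of "UNIV :: 'a set" "{0, 1}"] by simp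

lemma finite_field_power_CARD:
  fixes x :: "'a::{field,finite}"
  shows "x ^ CARD('a) = x"
proof (cases "x = 0")
  case True
  then show ?thesis using CARD_finite_field_gt_1[where 'a='a] by simp
next
  case False
  let ?R = "ring_of_type_algebra :: 'a ring"
  interpret R: Ring.field ?R by (rule field_from_type_algebra)
  interpret M: group "Multiplicative_Group.mult_of ?R" by (rule R.field_mult_group)
  have pow: "y [^]\<^bsub>Multiplicative_Group.mult_of ?R\<^esub> n = y ^ n" for y :: 'a and n :: nat
    by (induction n) (simp_all add: ring_of_type_algebra_def mult.commute)
  have "x \<in> carrier (Multiplicative_Group.mult_of ?R)"
    using False by (simp add: ring_of_type_algebra_def)
  moreover have "Coset.order (Multiplicative_Group.mult_of ?R) = CARD('a) - 1"
    by (subst R.order_mult_of) (simp_all add: Coset.order_def ring_of_type_algebra_def)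
  ultimately have "x ^ (CARD('a) - 1) = \<one>\<^bsub>Multiplicative_Group.mult_of ?R\<^esub>"
    using M.pow_order_eq_1[of x] by (simp only: pow)
  then have "x ^ (CARD('a) - 1) = 1" by (simp add: ring_of_type_algebra_def)
  then have "x ^ Suc (CARD('a) - 1) = x" by (simp only: power_Suc mult_1_right)
  moreover have "Suc (CARD('a) - 1) = CARD('a)"
    using CARD_finite_field_gt_1[where 'a='a] by simp
  ultimately show ?thesis by (simp only:)
qed

text \<open>A Sylow subgroup of the additive group for a prime \<open>r\<close> dividing the order contains a nonzero
  element killed by a power of \<open>r\<close>, so \<open>r\<close> is the characteristic.\<close>

lemma prime_dvd_CARD_imp_eq_CHAR:
  assumes r: "prime r" "r dvd CARD('a::{field,finite})"
  shows "r = CHAR('a)"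
proof -
  let ?G = "\<lparr>carrier = UNIV, mult = (+), one = 0\<rparr> :: 'a monoid"
  interpret G: group ?G
  proof (rule groupI)
    fix x :: 'a assume "x \<in> carrier ?G"
    show "\<exists>y\<in>carrier ?G. y \<otimes>\<^bsub>?G\<^esub> x = \<one>\<^bsub>?G\<^esub>"
      by (rule bexI[of _ "- x"]) simp_all
  qed (simp_all add: add.assoc)
  have pow: "y [^]\<^bsub>?G\<^esub> n = of_nat n * y" for y :: 'a and n :: nat
    by (induction n) (simp_all add: algebra_simps)
  define k where "k = multiplicity r CARD('a)"
  obtain m where m: "CARD('a) = r ^ k * m"
    unfolding k_def using multiplicity_dvd by blast
  have "k > 0"
    unfolding k_def using r by (simp add: prime_multiplicity_gt_zero_iff)
  obtain H where H: "subgroup H ?G" "card H = r ^ k"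
    using sylow_thm[OF r(1) G.is_group, of k m] m by (force simp: Coset.order_def)
  have "card H > 1"
    using H(2) \<open>k > 0\<close> prime_gt_1_nat[OF r(1)] by (metis one_less_power)
  then obtain x where x: "x \<in> H" "x \<noteq> 0"
    using card_mono[of "{0}" H] by fastforce
  interpret HG: group "?G\<lparr>carrier := H\<rparr>"
    using H(1) by (rule subgroup.subgroup_is_group) (rule G.is_group)
  have "x [^]\<^bsub>?G\<lparr>carrier := H\<rparr>\<^esub> Coset.order (?G\<lparr>carrier := H\<rparr>) = 0"
    using HG.pow_order_eq_1[of x] x by simp
  then have "of_nat (r ^ k) * x = 0"
    using H(2) pow[of x "r ^ k"] G.nat_pow_consistent[of x "r ^ k" H] by (simp add: Coset.order_def)
  then have "of_nat r = (0::'a)"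
    using x by simp
  then have "CHAR('a) dvd r" by (simp only: of_nat_eq_0_iff_char_dvd)
  moreover have "CHAR('a) \<noteq> 1" by simp
  ultimately show ?thesis
    using r(1) by (metis prime_nat_iff)
qed

lemma prime_CHAR_finite_field: "prime CHAR('a::{field,finite})"
  and CHAR_dvd_CARD_finite_field: "CHAR('a) dvd CARD('a)"
proof -
  obtain r where "prime r" "r dvd CARD('a)"
    using prime_factor_nat[of "CARD('a)"] CARD_finite_field_gt_1[where 'a='a] by auto
  then show "prime CHAR('a)" "CHAR('a) dvd CARD('a)"
    using prime_dvd_CARD_imp_eq_CHAR by blast+
qed

lemma CARD_eq_CHAR_power: "\<exists>n. CARD('a::{field,finite}) = CHAR('a) ^ n"
proof -
  have p: "prime CHAR('a)" by (rule prime_CHAR_finite_field)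
  obtain k m where m: "CARD('a) = CHAR('a) ^ k * m" "\<not> CHAR('a) dvd m"
    using multiplicity_decompose'[of "CARD('a)" "CHAR('a)"] p CARD_finite_field_gt_1[where 'a='a]
    by (metis gr0I not_prime_unit zero_less_card_finite not_one_less_zero)
  have "m = 1"
  proof (rule ccontr)
    assume "m \<noteq> 1"
    then obtain r where "prime r" "r dvd m" using prime_factor_nat by blast
    then show False
      using prime_dvd_CARD_imp_eq_CHAR[of r, where 'a='a] m by (metis dvd_mult)
  qed
  then show ?thesis using m(1) by (metis mult_1_right)
qed

lemma of_nat_CARD_eq_0: "of_nat CARD('a::{field,finite}) = (0 :: 'a alg_closure)"
  using CHAR_dvd_CARD_finite_field[where 'a='a] by (simp add: of_nat_eq_0_iff_char_dvd)

lemma frob_add: "(x + y :: 'a::{field,finite} alg_closure) ^ CARD('a) = x ^ CARD('a) + y ^ CARD('a)"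
  using CARD_eq_CHAR_power[where 'a='a] prime_CHAR_finite_field[where 'a='a]
  by (auto intro: freshmans_dream')

lemma frob_sum: "(\<Sum>i\<in>I. f i :: 'a::{field,finite} alg_closure) ^ CARD('a) = (\<Sum>i\<in>I. f i ^ CARD('a))"
  using CARD_eq_CHAR_power[where 'a='a] prime_CHAR_finite_field[where 'a='a]
  by (auto intro: freshmans_dream_sum')

lemma frob_diff: "(x - y :: 'a::{field,finite} alg_closure) ^ CARD('a) = x ^ CARD('a) - y ^ CARD('a)"
  using frob_add[of "x - y" y] by (simp add: algebra_simps)

lemma frob_inj: "x ^ CARD('a) = y ^ CARD('a) \<longleftrightarrow> x = (y :: 'a::{field,finite} alg_closure)"
  using frob_diff[of x y] CARD_finite_field_gt_1[where 'a='a] by auto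

lemma frob_to_ac: "to_ac (c :: 'a::{field,finite}) ^ CARD('a) = to_ac c"
  by (simp add: finite_field_power_CARD flip: to_ac_power)

lemma roots_card_le:
  fixes S :: "'k::idom set"
  assumes "n > 1" "\<And>x. x \<in> S \<Longrightarrow> x ^ n = x"
  shows "finite S \<and> card S \<le> n"
proof -
  let ?p = "monom 1 n - monom 1 1 :: 'k poly"
  have "coeff ?p n = 1" using assms(1) by simp
  then have p: "?p \<noteq> 0" by (metis coeff_0 zero_neq_one)
  have "degree ?p \<le> n" using assms(1) by (intro degree_diff_le) (auto simp: degree_monom_eq)
  moreover have "S \<subseteq> {x. poly ?p x = 0}" using assms(2) by (auto simp: poly_monom)
  ultimately show ?thesis
    using card_poly_roots_bound[OF p] poly_roots_finite[OF p]
    by (meson card_mono finite_subset le_trans)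
qed

text \<open>The elements of \<open>\<F>\<^sub>q\<close> are \<open>q\<close> roots of \<open>x\<^sup>q - x\<close>, which has no room for more.\<close>

lemma frob_fixed_iff: "x ^ CARD('a) = x \<longleftrightarrow> x \<in> range (to_ac :: 'a::{field,finite} \<Rightarrow> _)"
proof
  let ?S = "{x :: 'a alg_closure. x ^ CARD('a) = x}"
  have S: "finite ?S" "card ?S \<le> CARD('a)"
    using roots_card_le[of "CARD('a)" ?S] CARD_finite_field_gt_1[where 'a='a] by auto
  have sub: "range (to_ac :: 'a \<Rightarrow> _) \<subseteq> ?S" by (auto simp: frob_to_ac)
  have "range (to_ac :: 'a \<Rightarrow> _) = ?S"
    by (rule card_seteq[OF S(1) sub]) (simp add: card_image inj_to_ac S(2))
  then show "x \<in> range to_ac" if "x ^ CARD('a) = x" using that by auto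
qed (auto simp: frob_to_ac)

section \<open>Cubic polynomials and their Frobenius orbits of roots\<close>

lemma cyclic_index_3: "(1::3) + 1 = 2" "(2::3) + 1 = 3" "(3::3) + 1 = 1"
  "(1::3) - 1 = 3" "(2::3) - 1 = 1" "(3::3) - 1 = 2" "(0::3) = 3"
  by simp_all

lemma index_3_distinct: "(1::3) \<noteq> 2" "(1::3) \<noteq> 3" "(2::3) \<noteq> 1" "(2::3) \<noteq> 3" "(3::3) \<noteq> 1" "(3::3) \<noteq> 2"
  by simp_all

lemma map_poly_to_ac_coeff: "coeff (map_poly to_ac p) n = to_ac (coeff p n)"
  by (simp add: coeff_map_poly)

lemma degree_map_poly_to_ac: "degree (map_poly to_ac p) = degree p"
  by (cases "p = 0") (simp_all add: degree_map_poly)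

lemma poly_map_poly_to_ac: "poly (map_poly to_ac p) (to_ac c) = to_ac (poly p c)"
  by (simp add: poly_altdef map_poly_to_ac_coeff degree_map_poly_to_ac to_ac_sum)

lemma poly_map_poly_to_ac_frob:
  fixes p :: "'a::{field,finite} poly"
  shows "poly (map_poly to_ac p) (x ^ CARD('a)) = poly (map_poly to_ac p) x ^ CARD('a)"
  by (simp add: poly_altdef map_poly_to_ac_coeff frob_sum power_mult_distrib frob_to_ac
      flip: power_mult) (simp add: mult.commute)

lemma cubic_poly_eval:
  fixes p :: "'k::comm_ring_1 poly"
  assumes "degree p = 3" "coeff p 3 = 1"
  shows "poly p x = x ^ 3 + coeff p 2 * x ^ 2 + coeff p 1 * x + coeff p 0"
  using assms by (simp add: poly_altdef numeral_3_eq_3 numeral_2_eq_2 algebra_simps)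

text \<open>The Frobenius permutes the roots and fixes none of them. It cannot swap two of them either,
  because the third root would then be fixed; so it is a three-cycle on three distinct roots.\<close>

lemma cubic_frobenius_roots:
  fixes f :: "'a::{field,finite} poly"
  assumes f: "degree f = 3" "coeff f 3 = 1" and no_root: "\<And>c. poly f c \<noteq> 0"
  obtains l :: "3 \<Rightarrow> 'a alg_closure"
    where "inj l" "\<And>i. l (i + 1) = l i ^ CARD('a)" "\<And>i. poly (map_poly to_ac f) (l i) = 0"
proof -
  let ?g = "map_poly to_ac f"
  let ?q = "CARD('a)"
  have g: "degree ?g = 3" "coeff ?g 3 = 1"
    using f by (simp_all add: degree_map_poly_to_ac map_poly_to_ac_coeff)
  then obtain x1 where x1: "poly ?g x1 = 0"
    using alg_closed_imp_poly_has_root[of ?g] by auto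
  define x2 where "x2 = x1 ^ ?q"
  define x3 where "x3 = x2 ^ ?q"
  have x2: "poly ?g x2 = 0" and x3: "poly ?g x3 = 0" and x4: "poly ?g (x3 ^ ?q) = 0"
    using x1 by (simp_all add: x2_def x3_def poly_map_poly_to_ac_frob)
  have irrational: "r ^ ?q \<noteq> r" if "poly ?g r = 0" for r
  proof
    assume "r ^ ?q = r"
    then obtain c where "r = to_ac c" unfolding frob_fixed_iff by blast
    then show False using that no_root[of c] by (simp add: poly_map_poly_to_ac)
  qed
  have n12: "x1 \<noteq> x2" using irrational[OF x1] by (simp add: x2_def)
  have n23: "x2 \<noteq> x3" using irrational[OF x2] by (simp add: x3_def)
  have n13: "x1 \<noteq> x3"
  proof
    assume eq: "x1 = x3"
    \<comment> \<open>the third root, by Vieta's formula for the sum of the roots\<close>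
    define r where "r = - coeff ?g 2 - x1 - x2"
    have "r ^ ?q = 0 - coeff ?g 2 ^ ?q - x1 ^ ?q - x2 ^ ?q"
      unfolding r_def by (simp only: frob_diff flip: diff_0) (simp add: zero_power)
    then have "r ^ ?q = - coeff ?g 2 - x2 - x3"
      by (simp add: map_poly_to_ac_coeff frob_to_ac flip: x2_def x3_def)
    then have "r ^ ?q = r"
      using eq by (simp add: r_def)
    \<comment> \<open>linear interpolation: modulo \<open>(x - x1) (x - x2) (x - r)\<close> the cubic is at most linear\<close>
    moreover have "(x1 - x2) * poly ?g r = (r - x2) * poly ?g x1 - (r - x1) * poly ?g x2"
      unfolding cubic_poly_eval[OF g] r_def
      by (simp add: power2_eq_square power3_eq_cube algebra_simps)
    then have "poly ?g r = 0" using x1 x2 n12 by simp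
    ultimately show False using irrational by blast
  qed
  have x4': "x3 ^ ?q = x1"
  proof (rule ccontr)
    assume "x3 ^ ?q \<noteq> x1"
    moreover have "x3 ^ ?q \<noteq> x2" using n13 by (simp add: x2_def frob_inj)
    moreover have "x3 ^ ?q \<noteq> x3" using irrational[OF x3] .
    ultimately have "card {x1, x2, x3, x3 ^ ?q} = 4" using n12 n13 n23 by auto
    moreover have g0: "?g \<noteq> 0" using g by auto
    have "{x1, x2, x3, x3 ^ ?q} \<subseteq> {x. poly ?g x = 0}" using x1 x2 x3 x4 by blast
    then have "card {x1, x2, x3, x3 ^ ?q} \<le> degree ?g"
      by (rule order_trans[OF card_mono[OF poly_roots_finite[OF g0]] card_poly_roots_bound[OF g0]])
    ultimately show False using g by simp
  qed
  show ?thesis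
  proof (rule that[of "\<lambda>i. if i = 1 then x1 else if i = 2 then x2 else x3"])
    have "\<forall>i::3. \<forall>j. i \<noteq> j \<longrightarrow> (if i = 1 then x1 else if i = 2 then x2 else x3)
        \<noteq> (if j = 1 then x1 else if j = 2 then x2 else x3)"
      unfolding forall_3 using n12 n13 n23 by simp
    then show "inj (\<lambda>i::3. if i = 1 then x1 else if i = 2 then x2 else x3)"
      unfolding inj_def by blast
    have "\<forall>i::3. (if i + 1 = 1 then x1 else if i + 1 = 2 then x2 else x3)
        = (if i = 1 then x1 else if i = 2 then x2 else x3) ^ ?q"
      unfolding forall_3 cyclic_index_3 using x4' by (simp add: x2_def x3_def)
    then show "(if i + 1 = 1 then x1 else if i + 1 = 2 then x2 else x3)
        = (if i = 1 then x1 else if i = 2 then x2 else x3) ^ ?q" for i :: 3 by blast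
    show "poly ?g (if i = 1 then x1 else if i = 2 then x2 else x3) = 0" for i :: 3
      using x1 x2 x3 by simp
  qed
qed

text \<open>A polynomial over \<open>\<F>\<^sub>q\<close> with the root \<open>l 1\<close> vanishes on its whole Frobenius orbit, which here has
  as many points as the degree.\<close>

lemma cubic_unique:
  fixes f g :: "'a::{field,finite} poly" and l :: "3 \<Rightarrow> 'a alg_closure"
  assumes "degree f = 3" "coeff f 3 = 1" "degree g = 3" "coeff g 3 = 1"
    and l: "inj l" "\<And>i. l (i + 1) = l i ^ CARD('a)"
    and root: "poly (map_poly to_ac f) (l 1) = 0" "poly (map_poly to_ac g) (l 1) = 0"
  shows "f = g"
proof -
  have roots: "poly (map_poly to_ac f) (l i) = 0 \<and> poly (map_poly to_ac g) (l i) = 0" for i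
  proof -
    have "l 2 = l 1 ^ CARD('a)" "l 3 = l 2 ^ CARD('a)"
      using l(2)[of 1] l(2)[of 2] by simp_all
    then have "\<forall>i. poly (map_poly to_ac f) (l i) = 0 \<and> poly (map_poly to_ac g) (l i) = 0"
      unfolding forall_3 using root by (simp add: poly_map_poly_to_ac_frob)
    then show ?thesis by blast
  qed
  have "map_poly to_ac f = map_poly to_ac g"
  proof (rule poly_eqI_degree_lead_coeff[of _ 3 _ "range l"])
    show "card (range l) \<ge> 3" using l(1) by (simp add: card_image)
  qed (use assms roots in \<open>auto simp: degree_map_poly_to_ac map_poly_to_ac_coeff\<close>)
  then have "to_ac (coeff f n) = to_ac (coeff g n)" for n
    by (metis map_poly_to_ac_coeff)
  then show ?thesis by (simp add: poly_eq_iff)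
qed

lemma charpoly_3:
  fixes M :: "'k::comm_ring_1 ^ 3 ^ 3"
  shows "charpoly M =
    [: - det M, M$1$1 * M$2$2 + M$1$1 * M$3$3 + M$2$2 * M$3$3
         - M$1$2 * M$2$1 - M$1$3 * M$3$1 - M$2$3 * M$3$2, - (M$1$1 + M$2$2 + M$3$3), 1:]"
proof -
  have entry: "(mat [:0, 1:] - map_matrix (\<lambda>c. [:c:]) M) $ i $ j =
      (if i = j then [:- M$i$j, 1:] else [:- M$i$j:])" for i j
    by (simp add: mat_def)
  have ring: "p + 0 = p" "0 + p = p" for p :: "'k poly" by simp_all
  show ?thesis
    unfolding charpoly_def det_3 entry
    by (simp only: index_3_distinct simp_thms if_True if_False mult_pCons_left mult_zero_left
        smult_pCons smult_0_right add_pCons diff_pCons minus_pCons pCons_eq_iff ring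
        diff_zero pCons_0_0)
      (simp add: algebra_simps)
qed

lemma degree_charpoly_3: "degree (charpoly (M :: 'k::comm_ring_1 ^ 3 ^ 3)) = 3"
  by (simp add: charpoly_3)

lemma monic_charpoly_3: "coeff (charpoly (M :: 'k::comm_ring_1 ^ 3 ^ 3)) 3 = 1"
  by (simp add: charpoly_3 numeral_3_eq_3)

lemma poly_charpoly_3:
  fixes M :: "'a::field ^ 3 ^ 3"
  shows "poly (map_poly to_ac (charpoly M)) x = det (mat x - map_matrix to_ac M)"
  by (simp add: charpoly_3 map_poly_pCons det_3 mat_def algebra_simps)

lemma poly_charpoly_3_rational:
  fixes M :: "'a::field ^ 3 ^ 3"
  shows "poly (charpoly M) x = det (mat x - M)"
  by (simp add: charpoly_3 det_3 mat_def algebra_simps)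

lemma irreducible_cubic_iff_no_root:
  fixes f :: "'a::field poly"
  assumes f: "degree f = 3"
  shows "Factorial_Ring.irreducible f \<longleftrightarrow> (\<forall>c. poly f c \<noteq> 0)"
proof
  assume irr: "Factorial_Ring.irreducible f"
  show "\<forall>c. poly f c \<noteq> 0"
  proof (intro allI notI)
    fix c assume "poly f c = 0"
    then obtain h where h: "f = [:- c, 1:] * h" by (auto simp: poly_eq_0_iff_dvd)
    then have "degree f = 1 + degree h"
      using f by (cases "h = 0") (auto simp: degree_mult_eq simp del: mult_pCons_left)
    then have "degree h = 2" using f by simp
    moreover have "[:- c, 1:] dvd 1 \<or> h dvd 1" using irreducibleD[OF irr h] .
    moreover have "h \<noteq> 0" using f h by auto
    ultimately show False by (auto simp: is_unit_iff_degree)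
  qed
next
  assume no_root: "\<forall>c. poly f c \<noteq> 0"
  show "Factorial_Ring.irreducible f"
  proof (rule irreducibleI)
    show "f \<noteq> 0" using f by auto
    then show "\<not> f dvd 1" using f by (auto simp: is_unit_iff_degree)
    fix a b assume ab: "f = a * b"
    have linear: False if "degree p = 1" "p dvd f" for p
    proof -
      obtain u r where ur: "p = pCons u r" by (cases p) auto
      then have "degree r = 0" "r \<noteq> 0" using \<open>degree p = 1\<close> by (auto split: if_splits)
      then obtain v where "r = [:v:]" "v \<noteq> 0" by (metis degree_eq_zeroE pCons_0_0)
      then have p: "p = [:u, v:]" "v \<noteq> 0" using ur by simp_all
      then have "poly p (- u / v) = 0" by simp
      then have "poly f (- u / v) = 0" using \<open>p dvd f\<close> by (auto elim!: dvdE)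
      then show False using no_root by blast
    qed
    have "a \<noteq> 0" "b \<noteq> 0" using ab f by auto
    moreover then have "degree a + degree b = 3" using f ab by (simp add: degree_mult_eq)
    moreover have "degree a \<noteq> 1" "degree b \<noteq> 1"
      using linear[of a] linear[of b] ab by (metis dvd_triv_left dvd_triv_right)+
    ultimately have "degree a = 0 \<or> degree b = 0" by linarith
    then show "a dvd 1 \<or> b dvd 1"
      using \<open>a \<noteq> 0\<close> \<open>b \<noteq> 0\<close> by (auto simp: is_unit_iff_degree)
  qed
qed

lemma det_eq_0_kernel:
  fixes M :: "'k::field ^ 'n ^ 'n"
  assumes "det M = 0"
  obtains u :: "'k ^ 'n" where "u \<noteq> 0" "M *v u = 0"
proof -
  have "\<not> invertible M" using assms by (simp add: invertible_det_nz)
  then show ?thesis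
    using that by (auto simp: invertible_left_inverse matrix_left_invertible_ker)
qed

section \<open>The curve of a diagonal matrix in twisted coordinates\<close>

text \<open>Roots are split off one at a time; separability passes to the cofactor.\<close>

lemma separable_card_roots:
  fixes p :: "'k::alg_closed_field poly"
  assumes "p \<noteq> 0" "\<And>a. poly p a = 0 \<Longrightarrow> poly (pderiv p) a \<noteq> 0"
  shows "card {x. poly p x = 0} = degree p"
  using assms
proof (induction "degree p" arbitrary: p)
  case 0
  then have "{x. poly p x = 0} = {}" by (auto elim!: degree_eq_zeroE)
  then show ?case using 0 by (metis card.empty)
next
  case (Suc n)
  obtain a where a: "poly p a = 0"
    using alg_closed_imp_poly_has_root[of p] Suc.hyps(2) by auto
  then obtain r where p: "p = [:- a, 1:] * r" by (auto simp: poly_eq_0_iff_dvd)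
  have r0: "r \<noteq> 0" using p Suc.prems by auto
  have deriv: "poly (pderiv p) b = poly r b + (b - a) * poly (pderiv r) b" for b
    unfolding p pderiv_mult by (simp add: pderiv_pCons algebra_simps)
  have val: "poly p b = (b - a) * poly r b" for b
    by (simp add: p algebra_simps)
  have deg: "degree p = Suc (degree r)"
    unfolding p using r0 by (subst degree_mult_eq) auto
  have ra: "poly r a \<noteq> 0" using Suc.prems(2)[OF a] deriv[of a] by simp
  have "card {x. poly r x = 0} = degree r"
  proof (rule Suc.hyps(1))
    show "n = degree r" using Suc.hyps(2) deg by simp
    fix b assume "poly r b = 0"
    moreover from this have "poly p b = 0" by (simp add: val)
    ultimately show "poly (pderiv r) b \<noteq> 0"
      using Suc.prems(2)[of b] deriv[of b] by auto
  qed (rule r0)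
  moreover have "{x. poly p x = 0} = insert a {x. poly r x = 0}"
    by (auto simp: val)
  ultimately show ?case
    using ra poly_roots_finite[OF r0] deg by simp
qed

text \<open>Otherwise \<open>1 + x p(x)\<close> would be a nonconstant polynomial without roots.\<close>

lemma poly_eq_0_if_vanishes_off_0:
  fixes p :: "'k::alg_closed_field poly"
  assumes "\<And>x. x \<noteq> 0 \<Longrightarrow> poly p x = 0"
  shows "p = 0"
proof (rule ccontr)
  assume "p \<noteq> 0"
  then have "degree (pCons 1 p) > 0" by simp
  then obtain x where "poly (pCons 1 p) x = 0" using alg_closed_imp_poly_has_root by blast
  then show False using assms[of x] by (cases "x = 0") simp_all
qed

definition triple :: "'r::comm_ring_1 ^ 3 \<Rightarrow> 'r ^ 3 \<Rightarrow> 'r ^ 3 \<Rightarrow> 'r" where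
  "triple a b c = det (vector [a, b, c] :: 'r ^ 3 ^ 3)"

lemma triple_expand:
  "triple a b c = a$1 * (b$2 * c$3 - b$3 * c$2) + a$2 * (b$3 * c$1 - b$1 * c$3)
     + a$3 * (b$1 * c$2 - b$2 * c$1)"
  by (simp add: triple_def det_3 vector_3 algebra_simps)

lemma triple_matrix_mult: "triple (M *v a) (M *v b) (M *v c) = det M * triple a b c"
proof -
  have "(vector [M *v a, M *v b, M *v c] :: 'a ^ 3 ^ 3) = vector [a, b, c] ** transpose M"
    by (simp add: vec_eq_iff forall_3 vector_3 matrix_matrix_mult_def matrix_vector_mult_def
        transpose_def sum_3 mult.commute)
  then show ?thesis by (simp add: triple_def det_mul mult.commute)
qed

lemma triple_scale: "triple (r *s a) (s *s b) (t *s c) = r * s * t * triple a b c"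
  by (simp add: triple_expand algebra_simps)

definition diag :: "('n \<Rightarrow> 'r::zero) \<Rightarrow> 'r ^ 'n ^ 'n" where
  "diag d = (\<chi> i j. if i = j then d i else 0)"

lemma diag_nth: "diag d $ i $ j = (if i = j then d i else 0)"
  by (simp add: diag_def)

lemma diag_mult_vec: "(diag d *v x) $ i = d i * x $ i"
  by (simp add: matrix_vector_mult_def diag_nth if_distrib[of "\<lambda>c. c * _"] cong: if_cong)

text \<open>The Frobenius map on vectors, seen in coordinates with respect to three eigenvectors that it
  permutes cyclically (\<open>twist_P\<close> below).\<close>

definition twist :: "'a::{field,finite} alg_closure ^ 3 \<Rightarrow> 'a alg_closure ^ 3" where
  "twist x = (\<chi> i. x $ (i - 1) ^ CARD('a))"

text \<open>The form \<open>det (M v, \<phi> v, v)\<close> in such coordinates.\<close>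

definition twisted_form ::
    "'a::{field,finite} alg_closure ^ 3 ^ 3 \<Rightarrow> 'a alg_closure ^ 3 \<Rightarrow> 'a alg_closure" where
  "twisted_form M x = triple (M *v x) (twist x) x"

lemma matrix_vector_3: "(M *v x) $ i = M$i$1 * x$1 + M$i$2 * x$2 + M$i$3 * x$3"
  for M :: "'k::comm_ring_1 ^ 3 ^ 3"
  by (simp add: matrix_vector_mult_def sum_3)

lemma twist_nth: "twist x $ 1 = x$3 ^ CARD('a)" "twist x $ 2 = x$1 ^ CARD('a)"
  "twist x $ 3 = x$2 ^ CARD('a)" for x :: "'a::{field,finite} alg_closure ^ 3"
  by (simp_all add: twist_def cyclic_index_3)

lemma twisted_form_affine:
  fixes t :: "'a::{field,finite} alg_closure ^ 3 ^ 3"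
  defines "q \<equiv> CARD('a)"
  shows "twisted_form t (vector [u, w, 1]) =
    (t$1$1 * u + t$1$2 * w + t$1$3) * (u ^ q - w ^ q * w)
    + (t$2$1 * u + t$2$2 * w + t$2$3) * (w ^ q * u - 1)
    + (t$3$1 * u + t$3$2 * w + t$3$3) * (w - u ^ q * u)"
  by (simp add: twisted_form_def triple_expand twist_nth matrix_vector_3 vector_3 q_def)

lemma twisted_form_diag_affine:
  fixes d :: "3 \<Rightarrow> 'a::{field,finite} alg_closure"
  defines "q \<equiv> CARD('a)"
  shows "twisted_form (diag d) (vector [u, w, 1]) =
    (d 1 - d 3) * (u * u ^ q) + (d 2 - d 1) * (w * w ^ q) * u + (d 3 - d 2) * w"
  by (simp add: twisted_form_affine diag_nth q_def algebra_simps)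

text \<open>The derivative is \<open>a u\<^sup>q + b\<close>, because \<open>q = 0\<close> in the field. At a root, \<open>u\<close> times the derivative
  equals \<open>- c\<close>, so no root is multiple.\<close>

lemma curve_equation_card_roots:
  fixes a b c :: "'a::{field,finite} alg_closure"
  assumes "a \<noteq> 0" "c \<noteq> 0"
  shows "card {u. a * (u * u ^ CARD('a)) + b * u + c = 0} = CARD('a) + 1"
proof -
  let ?q = "CARD('a)"
  let ?g = "monom a (?q + 1) + [:c, b:]"
  have q: "?q > 1" by (rule CARD_finite_field_gt_1)
  have val: "poly ?g u = a * (u * u ^ ?q) + b * u + c" for u
    by (simp add: poly_monom algebra_simps)
  have deriv: "poly (pderiv ?g) u = a * u ^ ?q + b" for u
    using of_nat_CARD_eq_0[where 'a='a]
    by (simp add: pderiv_add pderiv_monom pderiv_pCons poly_monom)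
  have "degree (monom a (?q + 1)) = ?q + 1" using assms by (simp add: degree_monom_eq)
  moreover have "degree [:c, b:] \<le> 1" by simp
  ultimately have deg: "degree ?g = ?q + 1"
    using q by (subst degree_add_eq_left) linarith+
  have "card {x. poly ?g x = 0} = degree ?g"
  proof (rule separable_card_roots)
    show "?g \<noteq> 0" using deg by auto
    fix u assume "poly ?g u = 0"
    then have "u * poly (pderiv ?g) u + c = 0"
      unfolding val deriv by (simp add: algebra_simps)
    then show "poly (pderiv ?g) u \<noteq> 0" using assms by auto
  qed
  then show ?thesis unfolding deg val .
qed

text \<open>In the chart \<open>(u, w, 1)\<close> with \<open>w \<noteq> 0\<close> fixed, the curve of \<open>diag d\<close> has \<open>q + 1\<close> points \<open>u\<close>. The form of
  \<open>t\<close> has degree at most \<open>q + 2\<close> in \<open>u\<close>, so after subtraction of a linear multiple of the equation of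
  the curve a polynomial of degree at most \<open>q\<close> is left, which must vanish. Its coefficients of
  \<open>u\<^sup>0\<close> and \<open>u\<^sup>1\<close> are polynomials in \<open>w\<close> and must vanish identically too; they already force \<open>t\<close> to be
  diagonal with entries depending affinely on \<open>d\<close>.\<close>

lemma twisted_curve_determines_matrix:
  fixes d :: "3 \<Rightarrow> 'a::{field,finite} alg_closure"
  assumes d: "inj d"
    and sub: "\<And>x. twisted_form (diag d) x = 0 \<Longrightarrow> twisted_form t x = 0"
  obtains m n where "t = diag (\<lambda>i. m * d i + n)"
proof -
  let ?q = "CARD('a)"
  have q: "?q > 1" by (rule CARD_finite_field_gt_1)
  define a b c where "a = d 1 - d 3" and "b = d 2 - d 1" and "c = d 3 - d 2"
  have abc: "a \<noteq> 0" "b \<noteq> 0" "c \<noteq> 0" "a + c \<noteq> 0"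
    using d by (auto simp: a_def b_def c_def inj_eq)
  have coeffs:
    "a * (- (t$1$2 * w + t$1$3) * (w * w ^ ?q) - t$2$2 * w - t$2$3 + t$3$2 * w * w + t$3$3 * w)
       - (t$1$1 - t$3$3 - t$3$2 * w) * c * w = 0" (is "?c0 = 0")
    "a * ((t$2$2 - t$1$1) * (w * w ^ ?q) + t$2$3 * w ^ ?q - t$2$1 + t$3$1 * w)
       - (t$1$1 - t$3$3 - t$3$2 * w) * b * (w * w ^ ?q) + t$3$1 * c * w = 0" (is "?c1 = 0")
    if w: "w \<noteq> 0" for w
  proof -
    define S where "S = {u. a * (u * u ^ ?q) + b * (w * w ^ ?q) * u + c * w = 0}"
    have card_S: "card S = ?q + 1"
      unfolding S_def using curve_equation_card_roots[of a "c * w"] abc w by simp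
    \<comment> \<open>\<open>a\<close> times the form of \<open>t\<close>, reduced by \<open>(- t$3$1 u + (t$1$1 - t$3$3 - t$3$2 w))\<close> times the
      equation of the curve, which cancels the terms of degree \<open>q + 2\<close> and \<open>q + 1\<close> in \<open>u\<close>\<close>
    let ?f = "monom (a * (t$1$2 * w + t$1$3)) ?q
      + monom (a * t$2$1 * w ^ ?q + t$3$1 * b * (w * w ^ ?q)) 2 + [:?c0, ?c1:]"
    have "?f = 0"
    proof (rule poly_eqI_degree[where A = S])
      fix u assume u: "u \<in> S"
      then have "twisted_form (diag d) (vector [u, w, 1]) = 0"
        by (simp add: S_def twisted_form_diag_affine a_def b_def c_def)
      then have t0: "twisted_form t (vector [u, w, 1]) = 0" by (rule sub)
      have "poly ?f u = a * twisted_form t (vector [u, w, 1])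
        - (- t$3$1 * u + (t$1$1 - t$3$3 - t$3$2 * w))
          * (a * (u * u ^ ?q) + b * (w * w ^ ?q) * u + c * w)"
        unfolding twisted_form_affine by (simp add: poly_monom power2_eq_square algebra_simps)
      then show "poly ?f u = poly 0 u" using u t0 by (simp add: S_def)
    next
      have "degree [:?c0, ?c1:] \<le> ?q" using q by simp
      then have "degree ?f \<le> ?q"
        using q by (intro degree_add_le) (auto intro!: order_trans[OF degree_monom_le])
      then show "degree ?f < card S" using card_S by simp
    qed (use card_S in simp)
    \<comment> \<open>the coefficients of \<open>u\<^sup>2\<close> and \<open>u\<^sup>q\<close> are avoided: they collide for \<open>q = 2\<close>\<close>
    then have "coeff ?f 0 = 0" "coeff ?f 1 = 0" by (simp_all only: coeff_0)
    then show "?c0 = 0" "?c1 = 0" using q by (simp_all add: coeff_pCons)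
  qed
  \<comment> \<open>the left hand sides of \<open>coeffs\<close> as polynomials in \<open>w\<close>\<close>
  let ?C0 = "monom (- a * t$1$2) (?q + 2) + monom (- a * t$1$3) (?q + 1)
    + [:- a * t$2$3, a * (t$3$3 - t$2$2) - c * (t$1$1 - t$3$3), (a + c) * t$3$2:]"
  let ?C1 = "monom (b * t$3$2) (?q + 2) + monom (a * (t$2$2 - t$1$1) - b * (t$1$1 - t$3$3)) (?q + 1)
    + monom (a * t$2$3) ?q + [:- a * t$2$1, (a + c) * t$3$1:]"
  have "?C0 = 0"
  proof (rule poly_eq_0_if_vanishes_off_0)
    fix w :: "'a alg_closure" assume "w \<noteq> 0"
    from coeffs(1)[OF this] show "poly ?C0 w = 0"
      by (simp add: poly_monom power2_eq_square algebra_simps)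
  qed
  then have "coeff ?C0 0 = 0" "coeff ?C0 1 = 0" "coeff ?C0 2 = 0" "coeff ?C0 (?q + 1) = 0"
      "coeff ?C0 (?q + 2) = 0"
    by (simp_all only: coeff_0)
  then have C0: "t$2$3 = 0" "a * (t$3$3 - t$2$2) = c * (t$1$1 - t$3$3)" "t$3$2 = 0" "t$1$3 = 0"
      "t$1$2 = 0"
    using q abc by (auto simp: coeff_pCons numeral_2_eq_2 split: nat.splits)
  have "?C1 = 0"
  proof (rule poly_eq_0_if_vanishes_off_0)
    fix w :: "'a alg_closure" assume "w \<noteq> 0"
    from coeffs(2)[OF this] show "poly ?C1 w = 0"
      by (simp add: poly_monom power2_eq_square algebra_simps)
  qed
  then have "coeff ?C1 0 = 0" "coeff ?C1 1 = 0"
    by (simp_all only: coeff_0)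
  then have C1: "t$2$1 = 0" "t$3$1 = 0"
    using q abc by (auto simp: coeff_pCons split: nat.splits)
  define m where "m = (t$1$1 - t$3$3) / a"
  have m: "t$1$1 - t$3$3 = m * a" using abc(1) by (simp add: m_def)
  then have "t$1$1 = m * d 1 + (t$3$3 - m * d 3)" by (simp add: a_def algebra_simps)
  moreover have "a * (t$3$3 - t$2$2) = a * (m * c)" using C0(2) m by (simp add: algebra_simps)
  then have "t$3$3 - t$2$2 = m * c" using abc(1) by (metis mult_cancel_left)
  then have "t$2$2 = m * d 2 + (t$3$3 - m * d 3)" by (simp add: c_def algebra_simps)
  ultimately have "t = diag (\<lambda>i. m * d i + (t$3$3 - m * d 3))"
    using C0 C1 by (simp add: vec_eq_iff forall_3 diag_nth)
  then show ?thesis by (rule that)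
qed

section \<open>The form of a matrix and its singular points\<close>

definition frob :: "'a::{field,finite} alg_closure ^ 'n \<Rightarrow> 'a alg_closure ^ 'n" where
  "frob v = (\<chi> i. v $ i ^ CARD('a))"

lemma frob_nth: "frob v $ i = v $ i ^ CARD('a)" for v :: "'a::{field,finite} alg_closure ^ 'n"
  by (simp add: frob_def)

lemma frob_rational_matrix_vector:
  fixes M :: "'a::{field,finite} ^ 'n ^ 'm"
  shows "frob (map_matrix to_ac M *v v) = map_matrix to_ac M *v frob v"
  by (simp add: vec_eq_iff frob_nth matrix_vector_mult_def frob_sum power_mult_distrib frob_to_ac)

lemma frob_scale: "frob (c *s v) = c ^ CARD('a) *s frob v"
  for v :: "'a::{field,finite} alg_closure ^ 'n"
  by (simp add: vec_eq_iff frob_nth power_mult_distrib)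

text \<open>The vector \<open>(y\<^sup>q z - y z\<^sup>q, z\<^sup>q x - z x\<^sup>q, x\<^sup>q y - x y\<^sup>q)\<close> is the cross product of \<open>\<phi> v\<close> and \<open>v\<close>.\<close>

lemma form_at_triple:
  "form_at M v = triple (map_matrix to_ac (transpose M) *v v) (frob v) v"
  by (simp add: form_at_def plane_form_def Let_def triple_expand matrix_vector_3 sum_3 frob_nth
      vector_matrix_mult_def transpose_def vector_3 algebra_simps)

lemma form_at_scale: "form_at M (c *s v) = c * c ^ CARD('a) * c * form_at M v"
  for M :: "'a::{field,finite} ^ 3 ^ 3"
  by (simp add: form_at_triple frob_scale vector_scalar_commute triple_scale)

text \<open>The entries of \<open>\<phi> y\<close> are \<open>q\<close>-th powers and have derivative zero, so in \<open>det (T y, \<phi> y, y)\<close> only the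
  first and the last column are differentiated.\<close>

lemma pderiv_plane_form:
  fixes M :: "'a::{field,finite} ^ 3 ^ 3" and y :: "'a alg_closure poly ^ 3" and s :: "'a alg_closure"
  defines "v \<equiv> \<chi> j. poly (y $ j) s" and "v' \<equiv> \<chi> j. poly (pderiv (y $ j)) s"
  shows "poly (pderiv (plane_form CARD('a) (map_matrix (\<lambda>c. [:to_ac c:]) M) y)) s =
    triple (map_matrix to_ac (transpose M) *v v') (frob v) v
    + triple (map_matrix to_ac (transpose M) *v v) (frob v) v'"
  by (simp add: plane_form_def Let_def triple_expand matrix_vector_3 sum_3 frob_nth v_def v'_def
      vector_matrix_mult_def transpose_def vector_3 pderiv_add pderiv_mult pderiv_diff pderiv_power
      pderiv_smult of_nat_CARD_eq_0)
    (simp add: algebra_simps)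

lemma form_partial_triple:
  fixes M :: "'a::{field,finite} ^ 3 ^ 3"
  shows "form_partial M i v =
    triple (map_matrix to_ac (transpose M) *v axis i 1) (frob v) v
    + triple (map_matrix to_ac (transpose M) *v v) (frob v) (axis i 1)"
proof -
  have v: "(\<chi> j. poly ((\<chi> j. if j = i then [:0, 1:] else [:v $ j:]) $ j) (v $ i)) = v"
    by (simp add: vec_eq_iff)
  have v': "(\<chi> j. poly (pderiv ((\<chi> j. if j = i then [:0, 1:] else [:v $ j:]) $ j)) (v $ i)) = axis i 1"
    by (simp add: vec_eq_iff axis_def pderiv_pCons)
  show ?thesis unfolding form_partial_def pderiv_plane_form v v' ..
qed

text \<open>The differential of the form is linear in the direction \<open>e\<close>, so the partial derivatives determine it
  in every basis.\<close>

lemma triple_linear_basis: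
  fixes M :: "'k::comm_ring_1 ^ 3 ^ 3"
  shows "triple (M *v e) b c + triple a b e =
    (\<Sum>i\<in>UNIV. e $ i * (triple (M *v axis i 1) b c + triple a b (axis i 1)))"
  by (simp add: triple_expand matrix_vector_3 sum_3 axis_def index_3_distinct) (simp add: algebra_simps)

text \<open>Let \<open>X1\<close>, \<open>X2\<close>, \<open>X3\<close> be the three monomials of the form. Each partial derivative, multiplied by its
  variable, is a sum of two of them; as their total vanishes as well, each one does, in every
  characteristic. So at most one coordinate is nonzero, and the remaining term
  of the gradient kills it.\<close>

lemma diag_form_nonsingular:
  fixes d :: "3 \<Rightarrow> 'a::{field,finite} alg_closure"
  assumes d: "inj d" and zero: "twisted_form (diag d) x = 0"
    and grad: "\<And>e. triple (diag d *v e) (twist x) x + triple (diag d *v x) (twist x) e = 0"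
  shows "x = 0"
proof -
  let ?q = "CARD('a)"
  define a b c where "a = d 1 - d 3" and "b = d 2 - d 1" and "c = d 3 - d 2"
  have abc: "a \<noteq> 0" "b \<noteq> 0" "c \<noteq> 0"
    using d by (auto simp: a_def b_def c_def inj_eq)
  note simps = triple_expand diag_mult_vec twist_nth axis_def index_3_distinct a_def b_def c_def
  have g1: "a * (x$1 ^ ?q * x$3) + b * (x$2 ^ ?q * x$2) = 0"
    using grad[of "axis 1 1"] by (simp add: simps algebra_simps)
  have g2: "b * (x$2 ^ ?q * x$1) + c * (x$3 ^ ?q * x$3) = 0"
    using grad[of "axis 2 1"] by (simp add: simps algebra_simps)
  have g3: "c * (x$3 ^ ?q * x$2) + a * (x$1 ^ ?q * x$1) = 0"
    using grad[of "axis 3 1"] by (simp add: simps algebra_simps)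
  define X1 X2 X3 where "X1 = a * (x$1 ^ ?q * x$3 * x$1)" and "X2 = b * (x$2 ^ ?q * x$1 * x$2)"
    and "X3 = c * (x$3 ^ ?q * x$2 * x$3)"
  have "X1 + X2 = x$1 * (a * (x$1 ^ ?q * x$3) + b * (x$2 ^ ?q * x$2))"
    "X2 + X3 = x$2 * (b * (x$2 ^ ?q * x$1) + c * (x$3 ^ ?q * x$3))"
    "X3 + X1 = x$3 * (c * (x$3 ^ ?q * x$2) + a * (x$1 ^ ?q * x$1))"
    by (simp_all add: X1_def X2_def X3_def algebra_simps)
  then have s: "X1 + X2 = 0" "X2 + X3 = 0" "X3 + X1 = 0" using g1 g2 g3 by simp_all
  have "twisted_form (diag d) x = X1 + X2 + X3"
    by (simp add: twisted_form_def simps X1_def X2_def X3_def algebra_simps)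
  then have "X1 = 0" "X2 = 0" "X3 = 0" using zero s by (simp_all add: add.assoc)
  then have pairs: "x$1 = 0 \<or> x$3 = 0" "x$2 = 0 \<or> x$1 = 0" "x$3 = 0 \<or> x$2 = 0"
    using abc by (auto simp: X1_def X2_def X3_def)
  have q: "?q > 0" by simp
  have "x$1 = 0 \<and> x$2 = 0 \<and> x$3 = 0"
    using pairs g1 g2 g3 abc q by (auto simp: zero_power)
  then show ?thesis by (simp add: vec_eq_iff forall_3)
qed

section \<open>Frobenius eigenbases\<close>

text \<open>Apply \<open>(M - b) (M - c)\<close> to the relation.\<close>

lemma eigenvectors_sum_eq_0:
  fixes M :: "'k::field ^ 'n ^ 'n"
  assumes M: "M *v u = a *s u" "M *v v = b *s v" "M *v w = c *s w"
    and sum: "u + v + w = 0" and ne: "a \<noteq> b" "a \<noteq> c"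
  shows "u = 0"
proof -
  have lin: "M *v (r *s u + s *s v + t *s w) = (r * a) *s u + (s * b) *s v + (t * c) *s w" for r s t
    by (simp add: matrix_vector_right_distrib vector_scalar_commute M)
  have s1: "a *s u + b *s v + c *s w = 0"
    using lin[of 1 1 1] sum by simp
  have s2: "(a * a) *s u + (b * b) *s v + (c * c) *s w = 0"
    using lin[of a b c] s1 by simp
  have "u $ i = 0" for i
  proof -
    have e: "u$i + v$i + w$i = 0" "a * u$i + b * v$i + c * w$i = 0"
        "a * a * u$i + b * b * v$i + c * c * w$i = 0"
      using sum s1 s2 by (simp_all add: vec_eq_iff)
    have "(a - b) * (a - c) * u$i = (a * a * u$i + b * b * v$i + c * c * w$i)
        - (b + c) * (a * u$i + b * v$i + c * w$i) + b * c * (u$i + v$i + w$i)"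
      by (simp add: algebra_simps)
    then show ?thesis using e ne by simp
  qed
  then show ?thesis by (simp add: vec_eq_iff)
qed

text \<open>The rows of \<open>P\<close> are eigenvectors of \<open>A\<close> which the Frobenius permutes cyclically, like their
  eigenvalues \<open>l i\<close>. Indices live in the three-element ring, so \<open>i + 1\<close> is cyclic.\<close>

locale frobenius_eigenbasis =
  fixes A :: "'a::{field,finite} ^ 3 ^ 3" and l :: "3 \<Rightarrow> 'a alg_closure"
    and P Q :: "'a alg_closure ^ 3 ^ 3"
  assumes inj_l: "inj l" and l_Suc: "\<And>i. l (i + 1) = l i ^ CARD('a)"
    and PQ: "P ** Q = mat 1" and QP: "Q ** P = mat 1"
    and P_Suc: "\<And>i j. P $ (i + 1) $ j = P $ i $ j ^ CARD('a)"
    and P_diag: "P ** map_matrix to_ac (transpose A) = diag l ** P"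

text \<open>Start from an eigenvector that is normalised to have an entry 1 and take its conjugates. The third
  conjugate is again an eigenvector for the first eigenvalue, hence a multiple of the first one, and
  the normalisation makes them equal.\<close>

lemma frobenius_eigenbasis_exists:
  fixes A :: "'a::{field,finite} ^ 3 ^ 3"
  assumes irr: "Factorial_Ring.irreducible (charpoly A)"
  obtains l P Q where "frobenius_eigenbasis A l P Q"
proof -
  let ?q = "CARD('a)"
  let ?M = "map_matrix to_ac A"
  have "poly (charpoly A) c \<noteq> 0" for c
    using irr by (simp add: irreducible_cubic_iff_no_root degree_charpoly_3)
  then obtain l :: "3 \<Rightarrow> 'a alg_closure" where l: "inj l" "\<And>i. l (i + 1) = l i ^ ?q"
      "\<And>i. poly (map_poly to_ac (charpoly A)) (l i) = 0"
    using cubic_frobenius_roots[of "charpoly A"] by (metis degree_charpoly_3 monic_charpoly_3)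
  have ne: "l 1 \<noteq> l 2" "l 1 \<noteq> l 3" "l 2 \<noteq> l 3" using l(1) by (simp_all add: inj_eq)
  have "det (mat (l 1) - ?M) = 0" using l(3)[of 1] by (simp add: poly_charpoly_3)
  then obtain u where u: "u \<noteq> 0" "(mat (l 1) - ?M) *v u = 0" by (rule det_eq_0_kernel)
  then obtain k where k: "u $ k \<noteq> 0" by (auto simp: vec_eq_iff)
  define u1 where "u1 = inverse (u $ k) *s u"
  have mat_v: "mat c *v v = c *s v" for c :: "'a alg_closure" and v :: "'a alg_closure ^ 3"
    by (simp add: vec_eq_iff matrix_vector_mult_def mat_def if_distrib[of "\<lambda>c. c * _"] cong: if_cong)
  have "?M *v u = l 1 *s u"
    using u(2) by (simp add: matrix_vector_mult_diff_rdistrib mat_v)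
  then have M1: "?M *v u1 = l 1 *s u1"
    by (simp add: u1_def vector_scalar_commute mult.commute)
  have u1k: "u1 $ k = 1" using k by (simp add: u1_def)
  define u2 where "u2 = frob u1"
  define u3 where "u3 = frob u2"
  have M_frob: "?M *v frob v = (c ^ ?q) *s frob v" if "?M *v v = c *s v" for v c
    using that by (metis frob_rational_matrix_vector frob_scale)
  have M2: "?M *v u2 = l 2 *s u2" using M_frob[OF M1] l(2)[of 1] by (simp add: u2_def)
  have M3: "?M *v u3 = l 3 *s u3" using M_frob[OF M2] l(2)[of 2] by (simp add: u3_def)
  have M4: "?M *v frob u3 = l 1 *s frob u3" using M_frob[OF M3] l(2)[of 3] unfolding cyclic_index_3 by simp
  have k23: "u2 $ k = 1" "u3 $ k = 1" "frob u3 $ k = 1"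
    using u1k by (simp_all add: u2_def u3_def frob_nth)
  then have nz: "u1 \<noteq> 0" "u2 \<noteq> 0" "u3 \<noteq> 0" using u1k by auto
  define P :: "'a alg_closure ^ 3 ^ 3" where "P = (\<chi> i. if i = 1 then u1 else if i = 2 then u2 else u3)"
  have P_rows: "P $ 1 = u1" "P $ 2 = u2" "P $ 3 = u3"
    by (simp_all add: P_def)
  have comb: "transpose P *v y = y$1 *s u1 + y$2 *s u2 + y$3 *s u3" for y
    by (simp add: vec_eq_iff matrix_vector_3 transpose_def P_rows mult.commute)
  have scaled: "?M *v (c *s v) = b *s (c *s v)" if "?M *v v = b *s v" for b c v
    using that by (simp add: vector_scalar_commute mult.commute)
  have "det (transpose P) \<noteq> 0"
  proof
    assume "det (transpose P) = 0"
    then obtain y where y: "y \<noteq> 0" "transpose P *v y = 0" by (rule det_eq_0_kernel)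
    have s: "y$1 *s u1 + y$2 *s u2 + y$3 *s u3 = 0" using y(2) by (simp only: comb)
    have "y$1 *s u1 = 0"
      by (rule eigenvectors_sum_eq_0[OF scaled[OF M1] scaled[OF M2] scaled[OF M3] s]) (use ne in auto)
    moreover have "y$2 *s u2 = 0"
      by (rule eigenvectors_sum_eq_0[OF scaled[OF M2] scaled[OF M1] scaled[OF M3], of "y$2" "y$1" "y$3"])
        (use ne s in \<open>auto simp: add_ac\<close>)
    moreover have "y$3 *s u3 = 0"
      by (rule eigenvectors_sum_eq_0[OF scaled[OF M3] scaled[OF M1] scaled[OF M2], of "y$3" "y$1" "y$2"])
        (use ne s in \<open>auto simp: add_ac\<close>)
    ultimately have "y = 0" using nz by (simp add: vec_eq_iff forall_3) metis
    then show False using y by simp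
  qed
  then have inv: "invertible (transpose P)" by (simp add: invertible_det_nz)
  then obtain R where R: "transpose P ** R = mat 1" by (auto simp: invertible_def)
  define y where "y = R *v frob u3"
  have "transpose P *v y = frob u3" by (simp add: y_def matrix_vector_mul_assoc R)
  then have y: "frob u3 = y$1 *s u1 + y$2 *s u2 + y$3 *s u3" by (simp only: comb)
  have "?M *v (y$1 *s u1 - frob u3) = l 1 *s (y$1 *s u1 - frob u3)"
    by (simp add: matrix_vector_mult_diff_distrib vector_scalar_commute M1 M4 vector_ssub_ldistrib
        mult.commute)
  moreover have "(y$1 *s u1 - frob u3) + y$2 *s u2 + y$3 *s u3 = 0"
    using y by simp
  ultimately have "y$1 *s u1 - frob u3 = 0"
    using eigenvectors_sum_eq_0[OF _ scaled[OF M2] scaled[OF M3]] ne by blast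
  then have f3: "frob u3 = y$1 *s u1" by simp
  then have "y$1 = 1" using arg_cong[OF f3, of "\<lambda>v. v $ k"] u1k k23 by simp
  with f3 have f3: "frob u3 = u1" by simp
  have "invertible P" using inv by (simp add: invertible_det_nz)
  then obtain Q where Q: "P ** Q = mat 1" "Q ** P = mat 1" by (auto simp: invertible_def)
  have "frobenius_eigenbasis A l P Q"
  proof
    have "\<forall>i. P $ (i + 1) = frob (P $ i)"
      unfolding forall_3 cyclic_index_3 P_rows using f3 by (simp add: u2_def u3_def)
    then show "P $ (i + 1) $ j = P $ i $ j ^ ?q" for i j by (simp add: frob_nth)
    have rows: "\<forall>i. ?M *v (P $ i) = l i *s (P $ i)"
      unfolding forall_3 P_rows using M1 M2 M3 by simp
    have "(P ** map_matrix to_ac (transpose A)) $ i $ j = (diag l ** P) $ i $ j" for i j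
    proof -
      have "(P ** map_matrix to_ac (transpose A)) $ i $ j = (?M *v (P $ i)) $ j"
        by (simp add: matrix_matrix_mult_def matrix_vector_mult_def transpose_def mult.commute)
      also have "\<dots> = (diag l ** P) $ i $ j"
        using rows by (simp add: matrix_matrix_mult_def diag_nth if_distrib[of "\<lambda>c. c * _"] cong: if_cong)
      finally show ?thesis .
    qed
    then show "P ** map_matrix to_ac (transpose A) = diag l ** P" by (simp add: vec_eq_iff)
  qed (use l Q in auto)
  then show ?thesis by (rule that)
qed

section \<open>Nonsingularity\<close>

text \<open>A reducible cubic has a root in \<open>\<F>\<^sub>q\<close>. The corresponding eigenvector \<open>v\<close> of \<open>T\<close> over \<open>\<F>\<^sub>q\<close> satisfies
  \<open>\<phi> v = v\<close> and \<open>T v = c v\<close>, so the form and its differential vanish at \<open>v\<close>.\<close>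

lemma nonsingular_imp_irreducible:
  fixes A :: "'a::{field,finite} ^ 3 ^ 3"
  assumes "nonsingular_curve A"
  shows "Factorial_Ring.irreducible (charpoly A)"
proof (rule ccontr)
  assume "\<not> Factorial_Ring.irreducible (charpoly A)"
  then obtain c where "poly (charpoly A) c = 0"
    by (auto simp: irreducible_cubic_iff_no_root degree_charpoly_3)
  then have "det (transpose (mat c - A)) = 0" by (simp add: poly_charpoly_3_rational)
  moreover have "transpose (mat c - A) = mat c - transpose A"
    by (simp add: vec_eq_iff transpose_def mat_def)
  ultimately obtain v where v: "v \<noteq> 0" "(mat c - transpose A) *v v = 0"
    by (metis det_eq_0_kernel)
  define w where "w = (\<chi> i. to_ac (v $ i))"
  have w0: "w \<noteq> 0" using v(1) by (auto simp: w_def vec_eq_iff)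
  have frob_w: "frob w = w" by (simp add: vec_eq_iff frob_nth w_def frob_to_ac)
  have "transpose A *v v = c *s v"
    using v(2) by (simp add: vec_eq_iff matrix_vector_3 mat_def forall_3 index_3_distinct algebra_simps)
  then have "(\<Sum>j\<in>UNIV. A $ j $ i * v $ j) = c * v $ i" for i
    by (simp add: vec_eq_iff matrix_vector_mult_def transpose_def)
  then have "(\<Sum>j\<in>UNIV. to_ac (A $ j $ i) * to_ac (v $ j)) = to_ac c * to_ac (v $ i)" for i
    by (simp flip: to_ac_mult to_ac_sum)
  then have eig: "map_matrix to_ac (transpose A) *v w = to_ac c *s w"
    by (simp add: vec_eq_iff matrix_vector_mult_def transpose_def w_def)
  have "form_at A w = 0"
    unfolding form_at_triple eig frob_w by (simp add: triple_expand algebra_simps)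
  moreover have "form_partial A i w = 0" for i
    unfolding form_partial_triple eig frob_w by (simp add: triple_expand algebra_simps)
  ultimately have "proj_point w \<in> singular_points A"
    using w0 unfolding singular_points_def by blast
  then show False using assms by (simp add: nonsingular_curve_def)
qed

lemma map_matrix_to_ac_mult:
  "map_matrix to_ac (B ** C) = map_matrix to_ac B ** map_matrix to_ac C"
  by (simp add: vec_eq_iff matrix_matrix_mult_def to_ac_sum)

lemma map_matrix_to_ac_mat: "map_matrix to_ac (mat c) = mat (to_ac c)"
  by (simp add: vec_eq_iff mat_def)

lemma map_matrix_to_ac_inj: "map_matrix to_ac B = map_matrix to_ac C \<longleftrightarrow> B = C"
  by (simp add: vec_eq_iff)

lemma det_map_matrix_to_ac_3: "det (map_matrix to_ac B) = to_ac (det B)" for B :: "'a::field ^ 3 ^ 3"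
  by (simp add: det_3)

lemma sum_shift_3: "(\<Sum>k\<in>UNIV. f (k + 1)) = (\<Sum>k\<in>(UNIV::3 set). f k)"
  unfolding sum_3 cyclic_index_3 by (simp add: add_ac)

context frobenius_eigenbasis
begin

text \<open>The matrix \<open>B\<close> in the coordinates \<open>x = P v\<close>.\<close>

definition hat :: "'a ^ 3 ^ 3 \<Rightarrow> 'a alg_closure ^ 3 ^ 3" where
  "hat B = P ** map_matrix to_ac B ** Q"

lemma hat_P: "hat B ** P = P ** map_matrix to_ac B"
  by (simp add: hat_def matrix_mul_assoc[symmetric] QP)

lemma P_cancel_right: "Y ** P = Z ** P \<Longrightarrow> Y = Z"
  by (metis PQ matrix_mul_assoc matrix_mul_rid)

lemma P_cancel_left: "P ** Y = P ** Z \<Longrightarrow> Y = Z"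
  by (metis QP matrix_mul_assoc matrix_mul_lid)

lemma hat_mult: "hat (B ** C) = hat B ** hat C"
  by (rule P_cancel_right)
    (simp add: hat_P map_matrix_to_ac_mult matrix_mul_assoc[symmetric], simp add: hat_P matrix_mul_assoc)

lemma hat_mat: "hat (mat c) = mat (to_ac c)"
proof -
  have "P ** mat (to_ac c) = mat (to_ac c) ** P"
    by (simp add: vec_eq_iff matrix_matrix_mult_def mat_def if_distrib[of "\<lambda>c. c * _"]
        if_distrib[of "\<lambda>c. _ * c"] mult.commute cong: if_cong)
  then show ?thesis
    by (simp add: hat_def map_matrix_to_ac_mat matrix_mul_assoc[symmetric] PQ)
qed

lemma hat_inj: "hat B = hat C \<longleftrightarrow> B = C"
  by (metis P_cancel_left hat_P map_matrix_to_ac_inj)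

lemma hat_transpose_A: "hat (transpose A) = diag l"
  by (rule P_cancel_right) (simp add: hat_P P_diag)

lemma hat_affine:
  "hat (map_matrix ((*) m) B + mat n) = map_matrix ((*) (to_ac m)) (hat B) + mat (to_ac n)"
proof -
  have scale: "map_matrix ((*) r) C = mat r ** C" for r :: "'b::comm_ring_1" and C :: "'b ^ 3 ^ 3"
    by (simp add: vec_eq_iff matrix_matrix_mult_def mat_def if_distrib[of "\<lambda>c. c * _"] cong: if_cong)
  have add: "hat (B + C) = hat B + hat C" for B C
  proof -
    have "map_matrix to_ac (B + C) = map_matrix to_ac B + map_matrix to_ac C"
      by (simp add: vec_eq_iff)
    then show ?thesis
      by (simp add: hat_def vec_eq_iff matrix_matrix_mult_def distrib_left distrib_right sum.distrib)
  qed
  show ?thesis by (simp add: scale add hat_mult hat_mat)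
qed

lemma det_P_Q: "det P * det Q = 1"
  by (metis PQ det_I det_mul)

lemma det_hat: "det (hat B) = to_ac (det B)"
proof -
  have "det (hat B) = (det P * det Q) * to_ac (det B)"
    by (simp add: hat_def det_mul det_map_matrix_to_ac_3 mult_ac)
  then show ?thesis by (simp add: det_P_Q)
qed

lemma invertible_hat: "invertible (hat B) \<longleftrightarrow> invertible B"
  by (simp add: invertible_det_nz det_hat)

text \<open>The map \<open>M\<^sub>i\<^sub>j \<mapsto> M\<^sub>i\<^sub>-\<^sub>1\<^sub>,\<^sub>j\<^sub>-\<^sub>1\<^sup>q\<close> is multiplicative. The second factor is given by its own condition, so
  that this also applies to \<open>P\<close>, on which only the rows are rotated.\<close>

lemma twisted_mult:
  fixes Y Z Y' Z' :: "'a alg_closure ^ 3 ^ 3"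
  assumes "\<And>k. Y' $ (i + 1) $ (k + 1) = Y $ i $ k ^ CARD('a)"
    and "\<And>k. Z' $ (k + 1) $ j' = Z $ k $ j ^ CARD('a)"
  shows "(Y' ** Z') $ (i + 1) $ j' = ((Y ** Z) $ i $ j :: 'a alg_closure) ^ CARD('a)"
proof -
  have "(Y' ** Z') $ (i + 1) $ j' = (\<Sum>k\<in>UNIV. Y' $ (i + 1) $ (k + 1) * Z' $ (k + 1) $ j')"
    unfolding matrix_matrix_mult_def
    using sum_shift_3[of "\<lambda>k. Y' $ (i + 1) $ k * Z' $ k $ j'"] by simp
  then show ?thesis
    by (simp add: assms matrix_matrix_mult_def frob_sum power_mult_distrib)
qed

lemma P_frob_mult:
  assumes "\<And>k. C' $ k $ j = C $ k $ j ^ CARD('a)"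
  shows "(P ** C') $ (i + 1) $ j = ((P ** C) $ i $ j) ^ CARD('a)"
  using assms by (simp add: matrix_matrix_mult_def P_Suc frob_sum power_mult_distrib)

lemma index_shift: "(i::3) - 1 + 1 = i" by simp

lemma rows_eqI:
  assumes "\<And>i j. Y $ (i + 1) $ j = Z $ (i + 1) $ j"
  shows "Y = (Z :: 'b ^ 3 ^ 3)"
  using assms[of "_ - 1"] by (simp add: vec_eq_iff)

text \<open>Invariance under the Frobenius in the coordinates \<open>x = P v\<close>. The next two lemmas show that the
  matrices with this property are those that come from matrices over \<open>\<F>\<^sub>q\<close>.\<close>

definition twisted_matrix :: "'a alg_closure ^ 3 ^ 3 \<Rightarrow> bool" where
  "twisted_matrix Y \<longleftrightarrow> (\<forall>i j. Y $ (i + 1) $ (j + 1) = Y $ i $ j ^ CARD('a))"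

lemma twisted_matrix_hat: "twisted_matrix (hat B)"
proof -
  define Y where "Y = (\<chi> i j. hat B $ (i - 1) $ (j - 1) ^ CARD('a))"
  have "Y ** P = hat B ** P"
  proof (rule rows_eqI)
    fix i j
    have "(Y ** P) $ (i + 1) $ j = ((hat B ** P) $ i $ j) ^ CARD('a)"
      by (rule twisted_mult) (simp_all add: Y_def P_Suc)
    also have "\<dots> = (P ** map_matrix to_ac B) $ (i + 1) $ j"
      unfolding hat_P by (rule P_frob_mult[symmetric]) (simp add: frob_to_ac)
    finally show "(Y ** P) $ (i + 1) $ j = (hat B ** P) $ (i + 1) $ j" by (simp add: hat_P)
  qed
  then have "Y = hat B" by (rule P_cancel_right)
  then have "hat B $ (i + 1) $ (j + 1) = Y $ (i + 1) $ (j + 1)" for i j by simp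
  then show ?thesis by (simp add: twisted_matrix_def Y_def)
qed

lemma twisted_matrix_imp_hat:
  assumes "twisted_matrix Y"
  obtains B where "hat B = Y"
proof -
  define C where "C = Q ** Y ** P"
  define C' where "C' = (\<chi> i j. C $ i $ j ^ CARD('a))"
  have PC: "P ** C = Y ** P" by (simp add: C_def matrix_mul_assoc PQ)
  have "P ** C' = P ** C"
  proof (rule rows_eqI)
    fix i j
    have "(P ** C') $ (i + 1) $ j = ((P ** C) $ i $ j) ^ CARD('a)"
      by (rule P_frob_mult) (simp add: C'_def)
    also have "\<dots> = (Y ** P) $ (i + 1) $ j"
      unfolding PC using assms by (intro twisted_mult[symmetric]) (simp_all add: twisted_matrix_def P_Suc)
    finally show "(P ** C') $ (i + 1) $ j = (P ** C) $ (i + 1) $ j" by (simp add: PC)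
  qed
  then have "C' = C" by (rule P_cancel_left)
  then have "C' $ i $ j = C $ i $ j" for i j by (rule arg_cong)
  then have "C $ i $ j ^ CARD('a) = C $ i $ j" for i j
    by (simp add: C'_def)
  then have "C $ i $ j \<in> range to_ac" for i j by (simp only: frob_fixed_iff)
  then have "map_matrix to_ac (\<chi> i j. of_ac (C $ i $ j)) = C"
    by (simp add: vec_eq_iff to_ac_of_ac)
  then obtain B where B: "map_matrix to_ac B = C" by blast
  have "hat B ** P = Y ** P" unfolding hat_P B PC ..
  then have "hat B = Y" by (rule P_cancel_right)
  then show ?thesis by (rule that)
qed

lemma twist_P: "twist (P *v v) = P *v frob v"
proof -
  have "twist (P *v v) $ (i + 1) = (P *v frob v) $ (i + 1)" for i
    by (simp add: twist_def matrix_vector_mult_def P_Suc frob_nth frob_sum power_mult_distrib)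
  then have "twist (P *v v) $ i = (P *v frob v) $ i" for i
    by (metis index_shift)
  then show ?thesis by (simp add: vec_eq_iff)
qed

lemma twisted_form_hat:
  "twisted_form (hat (transpose M)) (P *v v) = det P * form_at M v"
proof -
  have "hat (transpose M) *v (P *v v) = P *v (map_matrix to_ac (transpose M) *v v)"
    by (simp add: matrix_vector_mul_assoc hat_P)
  then show ?thesis
    by (simp add: twisted_form_def twist_P triple_matrix_mult form_at_triple)
qed

lemma det_P_nz: "det P \<noteq> 0"
  using det_P_Q by auto

lemma P_Q_vec: "P *v (Q *v x) = x" "Q *v (P *v x) = x"
  by (simp_all add: matrix_vector_mul_assoc PQ QP)

lemma nonsingular: "nonsingular_curve A"
proof -
  have False if v: "v \<noteq> 0" "form_at A v = 0" "\<And>i. form_partial A i v = 0" for v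
  proof -
    let ?x = "P *v v" and ?T = "map_matrix to_ac (transpose A)"
    have "twisted_form (diag l) ?x = 0"
      using twisted_form_hat[of A v] v(2) by (simp add: hat_transpose_A)
    moreover have "triple (diag l *v e) (twist ?x) ?x + triple (diag l *v ?x) (twist ?x) e = 0" for e
    proof -
      let ?e = "Q *v e"
      have T: "diag l *v (P *v w) = P *v (?T *v w)" for w
        by (simp add: matrix_vector_mul_assoc P_diag)
      have "triple (?T *v ?e) (frob v) v + triple (?T *v v) (frob v) ?e = 0"
        unfolding triple_linear_basis[of ?T ?e] using v(3) by (simp add: form_partial_triple)
      then have "det P * triple (?T *v ?e) (frob v) v + det P * triple (?T *v v) (frob v) ?e = 0"
        by (simp flip: distrib_left)
      then show ?thesis
        by (simp add: T[of ?e, unfolded P_Q_vec] T[of v] twist_P P_Q_vec flip: triple_matrix_mult)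
    qed
    ultimately have "?x = 0" by (rule diag_form_nonsingular[OF inj_l])
    then have "v = 0" by (metis P_Q_vec(2) matrix_vector_mult_0_right)
    then show False using v(1) by simp
  qed
  then show ?thesis by (auto simp: nonsingular_curve_def singular_points_def)
qed

end

theorem nonsingular_curve_iff_irreducible:
  "nonsingular_curve A \<longleftrightarrow> Factorial_Ring.irreducible (charpoly A)"
  using nonsingular_imp_irreducible frobenius_eigenbasis_exists frobenius_eigenbasis.nonsingular
  by metis

section \<open>The matrices defining a given curve\<close>

lemma proj_point_eqD:
  assumes "proj_point v = proj_point w"
  obtains c where "v = c *s w"
proof -
  have "v \<in> proj_point v" unfolding proj_point_def by (simp add: vec.span_base)
  then have "v \<in> proj_point w" using assms by simp
  then show ?thesis using that by (auto simp: proj_point_def vec.span_singleton)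
qed

lemma proj_point_in_curve_iff:
  assumes "v \<noteq> 0"
  shows "proj_point v \<in> curve M \<longleftrightarrow> form_at M v = 0"
proof
  assume "proj_point v \<in> curve M"
  then obtain w where w: "proj_point v = proj_point w" "form_at M w = 0"
    by (auto simp: curve_def)
  then show "form_at M v = 0" by (auto elim!: proj_point_eqD simp: form_at_scale)
qed (use assms in \<open>auto simp: curve_def\<close>)

lemma form_at_affine:
  "form_at (map_matrix ((*) m) A + mat n) v = to_ac m * form_at A v"
  by (simp add: form_at_triple triple_expand matrix_vector_3 transpose_def mat_def index_3_distinct
      algebra_simps)

lemma curve_affine:
  assumes "m \<noteq> 0"
  shows "curve (map_matrix ((*) m) A + mat n) = curve A"
  using assms by (simp add: curve_def form_at_affine)

context frobenius_eigenbasis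
begin

lemma l_distinct: "l i = l j \<longleftrightarrow> i = j"
  using inj_l by (simp add: inj_eq)

text \<open>In the eigencoordinates the matrix is \<open>diag (m l\<^sub>i + n)\<close> with \<open>m, n\<close> in the algebraic closure.
  Invariance under the Frobenius gives \<open>(m\<^sup>q - m) l\<^sub>i + (n\<^sup>q - n) = 0\<close> for all \<open>i\<close>; since the
  \<open>l\<^sub>i\<close> differ, \<open>m\<close> and \<open>n\<close> are in \<open>\<F>\<^sub>q\<close>.\<close>

lemma curve_subset_imp_affine:
  assumes "curve A \<subseteq> curve M"
  obtains m n where "M = map_matrix ((*) m) A + mat n"
proof -
  have "twisted_form (hat (transpose M)) x = 0" if "twisted_form (diag l) x = 0" for x
  proof (cases "Q *v x = 0")
    case True
    then have "x = 0" by (metis P_Q_vec(1) matrix_vector_mult_0_right)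
    then show ?thesis by (simp add: twisted_form_def triple_expand)
  next
    case False
    have "form_at A (Q *v x) = 0"
      using that twisted_form_hat[of A "Q *v x"] det_P_nz by (simp add: hat_transpose_A P_Q_vec)
    then have "form_at M (Q *v x) = 0"
      using assms False by (auto simp flip: proj_point_in_curve_iff)
    then show ?thesis using twisted_form_hat[of M "Q *v x"] by (simp add: P_Q_vec)
  qed
  then obtain m n where mn: "hat (transpose M) = diag (\<lambda>i. m * l i + n)"
    using twisted_curve_determines_matrix[OF inj_l] by blast
  have "m * l (i + 1) + n = (m * l i + n) ^ CARD('a)" for i
    using twisted_matrix_hat[of "transpose M", unfolded mn twisted_matrix_def, rule_format, of i i]
    by (simp add: diag_nth)
  then have "m * l (i + 1) + n = m ^ CARD('a) * l (i + 1) + n ^ CARD('a)" for i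
    by (simp only: frob_add power_mult_distrib l_Suc)
  moreover have "(m ^ CARD('a) - m) * l (i + 1) + (n ^ CARD('a) - n)
      = (m ^ CARD('a) * l (i + 1) + n ^ CARD('a)) - (m * l (i + 1) + n)" for i
    by (simp add: algebra_simps)
  ultimately have eq: "(m ^ CARD('a) - m) * l (i + 1) + (n ^ CARD('a) - n) = 0" for i
    by simp
  have "(m ^ CARD('a) - m) * (l (1 + 1) - l (2 + 1)) = 0"
    using eq[of 1] eq[of 2] unfolding right_diff_distrib by (metis add_right_cancel cancel_comm_monoid_add_class.diff_cancel)
  then have m: "m ^ CARD('a) = m" unfolding cyclic_index_3 by (simp add: l_distinct)
  then have "n ^ CARD('a) = n" using eq[of 1] by simp
  with m obtain m' n' where m': "m = to_ac m'" "n = to_ac n'"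
    unfolding frob_fixed_iff by blast
  have "hat (transpose M) = hat (map_matrix ((*) m') (transpose A) + mat n')"
    unfolding mn hat_affine hat_transpose_A by (simp add: vec_eq_iff diag_nth mat_def m')
  then have "transpose M = map_matrix ((*) m') (transpose A) + mat n'" by (simp only: hat_inj)
  then have "M = map_matrix ((*) m') A + mat n'"
    by (simp add: vec_eq_iff transpose_def mat_def)
  then show ?thesis by (rule that)
qed

end

section \<open>The projective linear group and its action\<close>

lemma mat_mult_matrix: "(mat c ** B) = map_matrix ((*) c) B" for B :: "'r::comm_ring_1 ^ 3 ^ 3"
  by (simp add: vec_eq_iff matrix_matrix_mult_def mat_def if_distrib[of "\<lambda>c. c * _"] cong: if_cong)

lemma mat_comm: "mat c ** B = B ** mat c" for B :: "'r::comm_ring_1 ^ 3 ^ 3"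
  by (simp add: vec_eq_iff matrix_matrix_mult_def mat_def if_distrib[of "\<lambda>c. c * _"]
      if_distrib[of "\<lambda>c. _ * c"] mult.commute cong: if_cong)

lemma mat_mult_mat: "mat c ** mat d = (mat (c * d) :: 'r::comm_ring_1 ^ 3 ^ 3)"
  by (simp add: mat_mult_matrix) (simp add: vec_eq_iff mat_def)

lemma invertible_mat: "c \<noteq> 0 \<Longrightarrow> invertible (mat c :: 'k::field ^ 3 ^ 3)"
  by (simp add: invertible_det_nz det_3 mat_def)

definition proj_class :: "'k::field ^ 3 ^ 3 \<Rightarrow> ('k ^ 3 ^ 3) set" where
  "proj_class B = {mat c ** B | c. c \<noteq> 0}"

lemma group_GL3: "group (GL3 :: ('k::field ^ 3 ^ 3) monoid)"
proof (rule groupI)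
  fix B :: "'k ^ 3 ^ 3" assume "B \<in> carrier GL3"
  then obtain C where C: "B ** C = mat 1" "C ** B = mat 1" by (auto simp: GL3_def invertible_def)
  then have "invertible C" by (auto simp: invertible_def)
  then show "\<exists>C\<in>carrier GL3. C \<otimes>\<^bsub>GL3\<^esub> B = \<one>\<^bsub>GL3\<^esub>" using C by (auto simp: GL3_def)
qed (auto simp: GL3_def invertible_mult matrix_mul_assoc invertible_mat)

text \<open>The scalar matrices are central.\<close>

lemma scalars_normal: "{mat c | c. c \<noteq> 0} \<lhd> (GL3 :: ('k::field ^ 3 ^ 3) monoid)"
proof -
  interpret GL: group "GL3 :: ('k ^ 3 ^ 3) monoid" by (rule group_GL3)
  let ?Z = "{mat c | c. c \<noteq> 0} :: ('k ^ 3 ^ 3) set"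
  have Z: "subgroup ?Z GL3"
  proof (rule GL.subgroupI)
    show "?Z \<subseteq> carrier GL3" by (auto simp: GL3_def invertible_mat)
    show "?Z \<noteq> {}" by (auto intro: exI[of _ 1])
    show "inv\<^bsub>GL3\<^esub> a \<in> ?Z" if a: "a \<in> ?Z" for a
    proof -
      obtain c where c: "a = mat c" "c \<noteq> 0" using a by auto
      have "inv\<^bsub>GL3\<^esub> a = mat (inverse c)"
        by (rule GL.inv_equality) (use c in \<open>auto simp: GL3_def mat_mult_mat invertible_mat\<close>)
      then show ?thesis using c by auto
    qed
    show "a \<otimes>\<^bsub>GL3\<^esub> b \<in> ?Z" if "a \<in> ?Z" "b \<in> ?Z" for a b
      using that by (auto simp: GL3_def mat_mult_mat)
  qed
  show ?thesis
  proof (rule GL.normal_invI[OF Z])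
    fix x h :: "'k ^ 3 ^ 3" assume x: "x \<in> carrier GL3" and h: "h \<in> ?Z"
    then have hc: "h \<in> carrier GL3" by (auto simp: GL3_def invertible_mat)
    have "x \<otimes>\<^bsub>GL3\<^esub> h = h \<otimes>\<^bsub>GL3\<^esub> x" using h by (auto simp: GL3_def mat_comm)
    then have "x \<otimes>\<^bsub>GL3\<^esub> h \<otimes>\<^bsub>GL3\<^esub> inv\<^bsub>GL3\<^esub> x = h"
      using x hc by (simp add: GL.m_assoc)
    then show "x \<otimes>\<^bsub>GL3\<^esub> h \<otimes>\<^bsub>GL3\<^esub> inv\<^bsub>GL3\<^esub> x \<in> ?Z" using h by simp
  qed
qed

lemma proj_class_eq_coset: "{mat c | c. c \<noteq> 0} #>\<^bsub>GL3\<^esub> B = proj_class B"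
  by (auto simp: r_coset_def proj_class_def GL3_def)

lemma carrier_PGL3: "carrier PGL3 = proj_class ` {B. invertible B}"
  by (auto simp: PGL3_def FactGroup_def RCOSETS_def proj_class_eq_coset) (auto simp: GL3_def)

lemma group_PGL3: "group PGL3"
  unfolding PGL3_def by (rule normal.factorgroup_is_group[OF scalars_normal])

lemma proj_class_mult:
  assumes "invertible B" "invertible C"
  shows "proj_class B \<otimes>\<^bsub>PGL3\<^esub> proj_class C = proj_class (B ** C)"
  using normal.rcos_sum[OF scalars_normal, of B C] assms
  by (simp add: PGL3_def FactGroup_def proj_class_eq_coset) (simp add: GL3_def)

lemma one_PGL3: "\<one>\<^bsub>PGL3\<^esub> = proj_class (mat 1)"
  by (simp add: PGL3_def FactGroup_def proj_class_def)

lemma proj_class_self: "B \<in> proj_class B"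
  unfolding proj_class_def by (auto intro!: exI[of _ 1])

lemma proj_class_eqD:
  assumes "proj_class B = proj_class C"
  obtains c where "c \<noteq> 0" "B = mat c ** C"
  using proj_class_self[of B] that unfolding assms by (auto simp: proj_class_def)

lemma proj_class_scale:
  assumes c: "c \<noteq> 0"
  shows "proj_class (mat c ** B) = proj_class B"
proof -
  have "\<exists>e. mat d ** (mat c ** B) = mat e ** B \<and> e \<noteq> 0" if "d \<noteq> 0" for d
    using that c by (intro exI[of _ "d * c"]) (simp add: matrix_mul_assoc mat_mult_mat)
  moreover have "\<exists>e. mat d ** B = mat e ** (mat c ** B) \<and> e \<noteq> 0" if "d \<noteq> 0" for d
    using that c by (intro exI[of _ "d / c"]) (simp add: matrix_mul_assoc mat_mult_mat)
  ultimately show ?thesis unfolding proj_class_def by blast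
qed

lemma proj_point_scale:
  assumes c: "c \<noteq> 0"
  shows "proj_point (c *s v) = proj_point v"
proof -
  have "\<exists>e. d *s (c *s v) = e *s v" for d by (intro exI[of _ "d * c"]) simp
  moreover have "\<exists>e. d *s v = e *s (c *s v)" for d
    using c by (intro exI[of _ "d / c"]) simp
  ultimately show ?thesis unfolding proj_point_def vec.span_singleton by blast
qed

lemma to_ac_matrix_scale_vec:
  "map_matrix to_ac (mat c ** B) *v v = to_ac c *s (map_matrix to_ac B *v v)"
  for B :: "'a::field ^ 3 ^ 3"
  by (simp add: mat_mult_matrix vec_eq_iff matrix_vector_3 algebra_simps)

lemma pgl_act_proj_class:
  "pgl_act (proj_class B) (proj_point v) = proj_point (map_matrix to_ac B *v v)"
proof
  show "pgl_act (proj_class B) (proj_point v) \<subseteq> proj_point (map_matrix to_ac B *v v)"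
    by (auto simp: pgl_act_def proj_class_def proj_point_def vec.span_singleton
        to_ac_matrix_scale_vec vector_scalar_commute)
  show "proj_point (map_matrix to_ac B *v v) \<subseteq> pgl_act (proj_class B) (proj_point v)"
  proof
    fix w assume "w \<in> proj_point (map_matrix to_ac B *v v)"
    then obtain r where "w = r *s (map_matrix to_ac B *v v)"
      by (auto simp: proj_point_def vec.span_singleton)
    then have "w = map_matrix to_ac B *v (r *s v)" by (simp add: vector_scalar_commute)
    moreover have "r *s v \<in> proj_point v" by (auto simp: proj_point_def vec.span_singleton)
    ultimately show "w \<in> pgl_act (proj_class B) (proj_point v)"
      using proj_class_self[of B] unfolding pgl_act_def by blast
  qed
qed

lemma curve_points: "p \<in> curve A \<Longrightarrow> \<exists>v. p = proj_point v"
  by (auto simp: curve_def)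

lemma pgl_act_mult_image:
  assumes "\<And>p. p \<in> U \<Longrightarrow> \<exists>v. p = proj_point v"
  shows "pgl_act (proj_class (B ** C)) ` U = pgl_act (proj_class B) ` pgl_act (proj_class C) ` U"
proof -
  have "pgl_act (proj_class (B ** C)) p = pgl_act (proj_class B) (pgl_act (proj_class C) p)"
    if "p \<in> U" for p
    using assms[OF that]
    by (auto simp: pgl_act_proj_class map_matrix_to_ac_mult matrix_vector_mul_assoc)
  then show ?thesis by (simp add: image_image)
qed

lemma carrier_Aut_curve:
  "carrier (Aut_curve A) =
    {proj_class B | B. invertible B \<and> pgl_act (proj_class B) ` curve A = curve A}"
  by (auto simp: Aut_curve_def carrier_PGL3)

lemma Aut_curve_subgroup: "subgroup (carrier (Aut_curve A)) PGL3"
proof -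
  interpret PGL: group PGL3 by (rule group_PGL3)
  note mult = pgl_act_mult_image[OF curve_points]
  show ?thesis
  proof (rule PGL.subgroupI)
    show sub: "carrier (Aut_curve A) \<subseteq> carrier PGL3" by (auto simp: Aut_curve_def)
    have "pgl_act (proj_class (mat 1)) p = p" if "p \<in> curve A" for p
      using curve_points[OF that] by (auto simp: pgl_act_proj_class map_matrix_to_ac_mat)
    then have one: "pgl_act (proj_class (mat 1)) ` curve A = curve A" by simp
    then show "carrier (Aut_curve A) \<noteq> {}"
      using invertible_mat[of 1] by (force simp: carrier_Aut_curve)
    show "a \<otimes>\<^bsub>PGL3\<^esub> b \<in> carrier (Aut_curve A)"
      if a: "a \<in> carrier (Aut_curve A)" and b: "b \<in> carrier (Aut_curve A)" for a b
    proof -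
      obtain B C where B: "a = proj_class B" "invertible B" "pgl_act (proj_class B) ` curve A = curve A"
        and C: "b = proj_class C" "invertible C" "pgl_act (proj_class C) ` curve A = curve A"
        using a b by (auto simp: carrier_Aut_curve)
      have "pgl_act (proj_class (B ** C)) ` curve A = curve A" by (simp add: mult B C)
      then show ?thesis
        using B C by (auto simp: carrier_Aut_curve proj_class_mult intro: invertible_mult)
    qed
    show "inv\<^bsub>PGL3\<^esub> a \<in> carrier (Aut_curve A)" if a: "a \<in> carrier (Aut_curve A)" for a
    proof -
      obtain B where B: "a = proj_class B" "invertible B" "pgl_act (proj_class B) ` curve A = curve A"
        using a by (auto simp: carrier_Aut_curve)
      obtain C where C: "B ** C = mat 1" "C ** B = mat 1" using B(2) by (auto simp: invertible_def)
      then have inv_C: "invertible C" by (auto simp: invertible_def)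
      have "pgl_act (proj_class C) ` pgl_act (proj_class B) ` curve A = curve A"
        using one by (simp add: C flip: mult)
      then have "pgl_act (proj_class C) ` curve A = curve A" by (simp add: B(3))
      moreover have "inv\<^bsub>PGL3\<^esub> a = proj_class C"
        by (rule PGL.inv_equality)
          (use B C inv_C in \<open>auto simp: proj_class_mult one_PGL3 carrier_PGL3\<close>)
      ultimately show ?thesis using inv_C by (auto simp: carrier_Aut_curve)
    qed
  qed
qed

lemma Aut_curve_eq: "Aut_curve A = PGL3\<lparr>carrier := carrier (Aut_curve A)\<rparr>"
  by (simp add: Aut_curve_def)

lemma group_Aut_curve: "group (Aut_curve A)"
  by (subst Aut_curve_eq) (rule subgroup.subgroup_is_group[OF Aut_curve_subgroup group_PGL3])

lemma mult_Aut_curve: "monoid.mult (Aut_curve A) = monoid.mult PGL3" and one_Aut_curve: "one (Aut_curve A) = one PGL3"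
  by (simp_all add: Aut_curve_def)

text \<open>Since \<open>B\<close> commutes with \<open>\<phi>\<close>, the columns of \<open>det (B T v, \<phi> (B v), B v)\<close> have the common factor \<open>B\<close>.\<close>

lemma pgl_act_curve:
  fixes A :: "'a::{field,finite} ^ 3 ^ 3"
  assumes BC: "B ** C = mat 1" "C ** B = mat 1"
  shows "pgl_act (proj_class B) ` curve A = curve (transpose (B ** transpose A ** C))"
proof -
  let ?M = "transpose (B ** transpose A ** C)"
  let ?B = "map_matrix to_ac B" and ?C = "map_matrix to_ac C"
  have ac: "?B *v (?C *v v) = v" "?C *v (?B *v v) = v" for v
    by (simp_all add: matrix_vector_mul_assoc BC map_matrix_to_ac_mat flip: map_matrix_to_ac_mult)
  have nz: "?B *v v \<noteq> 0 \<longleftrightarrow> v \<noteq> 0" for v by (metis ac(2) matrix_vector_mult_0_right)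
  have "det B * det C = 1" by (metis BC(1) det_I det_mul)
  then have det: "det ?B \<noteq> 0" by (auto simp: det_map_matrix_to_ac_3)
  have form: "form_at ?M (?B *v v) = det ?B * form_at A v" for v
  proof -
    have "map_matrix to_ac (transpose ?M) *v (?B *v v) = ?B *v (map_matrix to_ac (transpose A) *v v)"
      by (simp add: map_matrix_to_ac_mult ac flip: matrix_vector_mul_assoc)
    then show ?thesis
      by (simp add: form_at_triple frob_rational_matrix_vector triple_matrix_mult)
  qed
  have "curve ?M = {proj_point (?B *v v) | v. v \<noteq> 0 \<and> form_at A v = 0}"
  proof
    show "curve ?M \<subseteq> {proj_point (?B *v v) | v. v \<noteq> 0 \<and> form_at A v = 0}"
    proof
      fix p assume "p \<in> curve ?M"
      then obtain w where w: "p = proj_point w" "w \<noteq> 0" "form_at ?M w = 0"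
        by (auto simp: curve_def)
      have "form_at A (?C *v w) = 0" using form[of "?C *v w"] w det by (simp add: ac)
      moreover have "?C *v w \<noteq> 0" using nz[of "?C *v w"] w by (simp add: ac)
      ultimately show "p \<in> {proj_point (?B *v v) | v. v \<noteq> 0 \<and> form_at A v = 0}"
        using w(1) ac(1)[of w] by force
    qed
    show "{proj_point (?B *v v) | v. v \<noteq> 0 \<and> form_at A v = 0} \<subseteq> curve ?M"
      using form nz by (auto simp: curve_def)
  qed
  also have "\<dots> = pgl_act (proj_class B) ` curve A"
    by (auto simp: curve_def pgl_act_proj_class intro!: image_eqI)
  finally show ?thesis by simp
qed

section \<open>A primitive element of the cubic extension\<close>

context frobenius_eigenbasis
begin

lemma l_orbit: "l 2 = l 1 ^ CARD('a)" "l 3 = l 2 ^ CARD('a)" "l 1 = l 3 ^ CARD('a)"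
  using l_Suc[of 1] l_Suc[of 2] l_Suc[of 3] unfolding cyclic_index_3 by auto

text \<open>The elements \<open>a + b \<lambda> + c \<lambda>\<^sup>2\<close> lie in the set and are distinct, because a difference of two of them
  is a polynomial of degree at most two with the three roots \<open>l i\<close>.\<close>

lemma card_cubic_extension: "card {x :: 'a alg_closure. x ^ (CARD('a) ^ 3) = x} = CARD('a) ^ 3"
  (is "card ?S = ?q ^ 3")
proof -
  have q: "?q > 1" by (rule CARD_finite_field_gt_1)
  then have "?q ^ 3 > 1" by (metis one_less_power zero_less_numeral)
  then have S: "finite ?S" "card ?S \<le> ?q ^ 3" using roots_card_le[of "?q ^ 3" ?S] by auto
  have pow3: "x ^ (?q ^ 3) = ((x ^ ?q) ^ ?q) ^ ?q" for x :: "'a alg_closure"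
    by (simp add: power3_eq_cube flip: power_mult)
  define f where "f = (\<lambda>(a, b, c). poly (map_poly to_ac [:a, b, c :: 'a:]) (l 1))"
  have "inj f"
  proof (rule injI)
    fix s t assume st: "f s = f t"
    obtain a b c a' b' c' where abc: "s = (a, b, c)" "t = (a', b', c')" by (metis prod_cases3)
    let ?p = "map_poly to_ac [:a - a', b - b', c - c':]"
    have 1: "poly ?p (l 1) = 0"
      using st by (simp add: f_def abc map_poly_pCons algebra_simps)
    then have 2: "poly ?p (l 2) = 0" unfolding l_orbit(1) by (simp only: poly_map_poly_to_ac_frob) simp
    then have 3: "poly ?p (l 3) = 0" unfolding l_orbit(2) by (simp only: poly_map_poly_to_ac_frob) simp
    have "?p = 0"
    proof (rule poly_eqI_degree[where A = "range l"])
      have "\<forall>i. poly ?p (l i) = 0" unfolding forall_3 using 1 2 3 by blast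
      then show "poly ?p x = poly 0 x" if "x \<in> range l" for x using that by auto
      have "degree [:a - a', b - b', c - c':] \<le> 2" by simp
      then show "degree ?p < card (range l)" unfolding degree_map_poly_to_ac
        by (simp add: card_image[OF inj_l])
    qed (simp add: card_image[OF inj_l])
    then show "s = t" by (simp add: abc map_poly_pCons)
  qed
  moreover have "range f \<subseteq> ?S"
  proof
    fix x assume "x \<in> range f"
    then obtain p where x: "x = poly (map_poly to_ac p) (l 1)" by (auto simp: f_def)
    have "x ^ (?q ^ 3) = poly (map_poly to_ac p) (((l 1 ^ ?q) ^ ?q) ^ ?q)"
      unfolding pow3 x poly_map_poly_to_ac_frob ..
    also have "((l 1 ^ ?q) ^ ?q) ^ ?q = l 1" by (simp only: l_orbit[symmetric])
    finally show "x \<in> ?S" using x by simp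
  qed
  ultimately have "CARD('a \<times> 'a \<times> 'a) = card (range f)" "card (range f) \<le> card ?S"
    using card_mono[OF S(1), of "range f"] card_image[of f UNIV] by simp_all
  moreover have "CARD('a \<times> 'a \<times> 'a) = ?q ^ 3" by (simp add: power3_eq_cube)
  ultimately show ?thesis using S(2) by linarith
qed

text \<open>The fixed points of the \<open>q\<^sup>3\<close>-th power map are a finite field, so their multiplicative group is cyclic.\<close>

lemma primitive_element:
  obtains g :: "'a alg_closure" where "g \<noteq> 0" "g ^ (CARD('a) ^ 3) = g"
    "\<forall>x. x \<noteq> 0 \<longrightarrow> x ^ (CARD('a) ^ 3) = x \<longrightarrow> (\<exists>n. x = g ^ n)"
    "\<forall>n. g ^ n = 1 \<longleftrightarrow> CARD('a) ^ 3 - 1 dvd n"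
proof -
  let ?q = "CARD('a)"
  let ?S = "{x :: 'a alg_closure. x ^ (?q ^ 3) = x}"
  let ?R = "\<lparr>carrier = ?S, monoid.mult = (*), one = 1, ring.zero = 0, add = (+)\<rparr> :: 'a alg_closure ring"
  have q: "?q > 1" by (rule CARD_finite_field_gt_1)
  have pow3: "x ^ (?q ^ 3) = ((x ^ ?q) ^ ?q) ^ ?q" for x :: "'a alg_closure"
    by (simp add: power3_eq_cube flip: power_mult)
  have zero: "(0 :: 'a alg_closure) ^ (?q ^ 3) = 0" using q by (simp add: zero_power)
  have add: "(x + y) ^ (?q ^ 3) = x ^ (?q ^ 3) + y ^ (?q ^ 3)" for x y :: "'a alg_closure"
    unfolding pow3 frob_add ..
  have diff: "(x - y) ^ (?q ^ 3) = x ^ (?q ^ 3) - y ^ (?q ^ 3)" for x y :: "'a alg_closure"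
    unfolding pow3 frob_diff ..
  have minus: "(- x) ^ (?q ^ 3) = - (x ^ (?q ^ 3))" for x :: "'a alg_closure"
    using diff[of 0 x] zero by simp
  have "\<exists>y\<in>?S. y + x = 0" if "x \<in> ?S" for x
    using that minus by (intro bexI[of _ "- x"]) auto
  then have "abelian_group ?R"
    by (intro abelian_groupI) (auto simp: add zero algebra_simps)
  moreover have "Group.comm_monoid ?R"
    by (intro comm_monoidI) (auto simp: power_mult_distrib mult_ac)
  ultimately have "cring ?R"
    by (intro cringI) (auto simp: algebra_simps)
  then interpret R: Ring.field ?R
  proof (rule cring.cring_fieldI2)
    show "\<zero>\<^bsub>?R\<^esub> \<noteq> \<one>\<^bsub>?R\<^esub>" by simp
    show "\<exists>y\<in>carrier ?R. x \<otimes>\<^bsub>?R\<^esub> y = \<one>\<^bsub>?R\<^esub>" if "x \<in> carrier ?R" "x \<noteq> \<zero>\<^bsub>?R\<^esub>" for x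
      using that by (intro bexI[of _ "inverse x"]) (auto simp: power_inverse)
  qed
  let ?M = "Multiplicative_Group.mult_of ?R"
  interpret M: group ?M by (rule R.field_mult_group)
  have pow: "x [^]\<^bsub>?M\<^esub> n = x ^ n" for x and n :: nat
    by (induction n) (simp_all add: mult.commute)
  have powR: "x [^]\<^bsub>?R\<^esub> n = x ^ n" for x and n :: nat
    by (induction n) (simp_all add: mult.commute)
  have card_S: "card ?S = ?q ^ 3" by (rule card_cubic_extension)
  then have fin: "finite ?S" using q by (intro card_ge_0_finite) simp
  then have "finite (carrier ?R)" by simp
  from R.finite_field_mult_group_has_gen[OF this]
  obtain g where g: "g \<in> carrier ?M" "carrier ?M = {g [^]\<^bsub>?R\<^esub> i | i::nat. i \<in> UNIV}"
    by (rule bexE)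
  have fin_M: "finite (carrier ?M)" using fin by simp
  have "M.ord g = card (generate ?M {g})" by (rule M.generate_pow_card[OF g(1)])
  also have "generate ?M {g} = carrier ?M"
    unfolding M.generate_pow_on_finite_carrier[OF fin_M g(1)] g(2) pow powR ..
  also have "card \<dots> = ?q ^ 3 - 1" using card_S fin zero by simp
  finally have ord: "M.ord g = ?q ^ 3 - 1" .
  show ?thesis
  proof (rule that[of g])
    show "g \<noteq> 0" "g ^ (?q ^ 3) = g" using g(1) by auto
    show "\<forall>x. x \<noteq> 0 \<longrightarrow> x ^ (?q ^ 3) = x \<longrightarrow> (\<exists>n. x = g ^ n)"
    proof (intro allI impI)
      fix x :: "'a alg_closure" assume "x \<noteq> 0" "x ^ (?q ^ 3) = x"
      then have "x \<in> carrier ?M" by simp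
      then show "\<exists>n. x = g ^ n" unfolding g(2) powR by blast
    qed
    show "\<forall>n. g ^ n = 1 \<longleftrightarrow> ?q ^ 3 - 1 dvd n"
      using M.pow_eq_id[OF g(1)] unfolding ord pow by simp
  qed
qed

end

section \<open>Automorphisms as monomial matrices\<close>

text \<open>The induction principle of the cyclic group of order three.\<close>

lemma index_3_cycle:
  fixes i j :: 3
  assumes "p i" "\<And>k. p k \<Longrightarrow> p (k + 1)"
  shows "p j"
proof -
  have "p i \<longrightarrow> p (i + 1) \<and> p (i + 1 + 1)" using assms(2) by blast
  then have "p i" "p (i + 1)" "p (i + 1 + 1)" using assms(1) by auto
  moreover have "\<forall>i j :: 3. j = i \<or> j = i + 1 \<or> j = i + 1 + 1"
    unfolding forall_3 cyclic_index_3 by simp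
  ultimately show ?thesis by metis
qed

definition monomial :: "3 \<Rightarrow> 'r::zero ^ 3 ^ 3 \<Rightarrow> bool" where
  "monomial k M \<longleftrightarrow> (\<forall>i j. M $ i $ j \<noteq> 0 \<longleftrightarrow> j = i + k)"

lemma monomial_unique: "monomial k M \<Longrightarrow> monomial k' M \<Longrightarrow> k = k'"
  unfolding monomial_def by (metis add_left_cancel)

lemma monomial_mult:
  fixes M N :: "'k::idom ^ 3 ^ 3"
  assumes "monomial k M" "monomial k' N"
  shows "monomial (k + k') (M ** N)"
  unfolding monomial_def
proof (intro allI)
  fix i j
  have "M $ i $ m = 0" if "m \<noteq> i + k" for m using assms(1) that unfolding monomial_def by blast
  then have "(M ** N) $ i $ j = (\<Sum>m\<in>UNIV. if m = i + k then M $ i $ m * N $ m $ j else 0)"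
    unfolding matrix_matrix_mult_def vec_lambda_beta by (intro sum.cong refl) auto
  then have "(M ** N) $ i $ j = M $ i $ (i + k) * N $ (i + k) $ j" by simp
  then show "(M ** N) $ i $ j \<noteq> 0 \<longleftrightarrow> j = i + (k + k')"
    using assms unfolding monomial_def by (simp add: add.assoc)
qed

lemma monomial_scale:
  fixes M :: "'k::idom ^ 3 ^ 3"
  shows "c \<noteq> 0 \<Longrightarrow> monomial k (mat c ** M) \<longleftrightarrow> monomial k M"
  by (simp add: monomial_def mat_mult_matrix)

lemma monomial_0_diag:
  assumes "monomial 0 M"
  shows "M = diag (\<lambda>i. M $ i $ i)" "M $ i $ i \<noteq> 0"
proof -
  have entry: "M $ i $ j \<noteq> 0 \<longleftrightarrow> j = i" for i j using assms by (simp add: monomial_def)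
  show "M $ i $ i \<noteq> 0" by (simp add: entry)
  have "M $ i $ j = diag (\<lambda>i. M $ i $ i) $ i $ j" for i j
    using entry[of i j] by (cases "i = j") (auto simp: diag_nth)
  then show "M = diag (\<lambda>i. M $ i $ i)" unfolding vec_eq_iff by blast
qed

lemma monomial_diag: "monomial 0 (diag d) \<longleftrightarrow> (\<forall>i. d i \<noteq> 0)"
  by (auto simp: monomial_def diag_nth)

lemma diag_mult_nth:
  "(diag d ** M) $ i $ j = d i * M $ i $ j" "(M ** diag d) $ i $ j = M $ i $ j * d j"
  by (simp_all add: matrix_matrix_mult_def diag_nth if_distrib[of "\<lambda>c. c * _"]
      if_distrib[of "\<lambda>c. _ * c"] cong: if_cong)

lemma diag_mult_diag: "diag d ** diag e = diag (\<lambda>i. d i * e i :: 'r::semiring_1)"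
  by (simp add: vec_eq_iff diag_mult_nth) (simp add: diag_nth)

lemma diag_eq_iff: "diag d = diag e \<longleftrightarrow> d = e"
proof
  assume eq: "diag d = diag e"
  have "diag d $ i $ i = diag e $ i $ i" for i unfolding eq ..
  then show "d = e" by (simp add: diag_nth fun_eq_iff)
qed simp

lemma mat_eq_diag: "mat c = diag (\<lambda>_. c)"
  by (simp add: mat_def diag_def)

context frobenius_eigenbasis
begin

text \<open>The rotation by \<open>k\<close> of the eigenvalues is induced by an affine map over \<open>\<F>\<^sub>q\<close>.\<close>

definition affine_shift :: "3 \<Rightarrow> bool" where
  "affine_shift k \<longleftrightarrow> (\<exists>m n. \<forall>i. l (i + k) = to_ac m * l i + to_ac n)"

lemma affine_shift_0: "affine_shift 0"
  unfolding affine_shift_def by (intro exI[of _ 1] exI[of _ 0]) simp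

text \<open>The condition on the right says entrywise that \<open>B T = (m T + n E) B\<close>. By \<open>pgl_act_curve\<close> and
  \<open>curve_subset_imp_affine\<close> this is what it means to preserve the curve; the case \<open>m = 0\<close>, where
  \<open>m A + n E\<close> has zero form, would make \<open>T\<close> scalar.\<close>

lemma proj_class_in_Aut_iff_relation:
  assumes B: "invertible B"
  shows "proj_class B \<in> carrier (Aut_curve A) \<longleftrightarrow>
    (\<exists>m n. \<forall>i j. hat B $ i $ j \<noteq> 0 \<longrightarrow> l j = to_ac m * l i + to_ac n)"
proof -
  obtain C where C: "B ** C = mat 1" "C ** B = mat 1" using B by (auto simp: invertible_def)
  let ?T = "transpose A" and ?M = "transpose (B ** transpose A ** C)"
  have rel: "?M = map_matrix ((*) m) A + mat n \<longleftrightarrow>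
      (\<forall>i j. hat B $ i $ j \<noteq> 0 \<longrightarrow> l j = to_ac m * l i + to_ac n)" for m n
  proof -
    have "?M = map_matrix ((*) m) A + mat n \<longleftrightarrow> B ** ?T ** C = map_matrix ((*) m) ?T + mat n"
      by (simp add: vec_eq_iff transpose_def mat_def) metis
    also have "\<dots> \<longleftrightarrow> B ** ?T = (map_matrix ((*) m) ?T + mat n) ** B"
      by (metis C matrix_mul_assoc matrix_mul_rid)
    also have "\<dots> \<longleftrightarrow> hat B ** diag l = (map_matrix ((*) (to_ac m)) (diag l) + mat (to_ac n)) ** hat B"
      by (simp only: hat_mult hat_affine hat_transpose_A flip: hat_inj)
    also have "map_matrix ((*) (to_ac m)) (diag l) + mat (to_ac n) = diag (\<lambda>i. to_ac m * l i + to_ac n)"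
      by (simp add: vec_eq_iff diag_nth mat_def)
    also have "hat B ** diag l = diag (\<lambda>i. to_ac m * l i + to_ac n) ** hat B \<longleftrightarrow>
        (\<forall>i j. hat B $ i $ j \<noteq> 0 \<longrightarrow> l j = to_ac m * l i + to_ac n)"
      by (simp only: vec_eq_iff diag_mult_nth) (auto simp: mult.commute)
    finally show ?thesis .
  qed
  have m0: "m \<noteq> 0" if "?M = map_matrix ((*) m) A + mat n" for m n
  proof
    assume "m = 0"
    have "det (hat B) \<noteq> 0" using B by (simp add: det_hat invertible_det_nz)
    then have "hat B \<noteq> 0" by (auto simp: det_3)
    then obtain i j where ij: "hat B $ i $ j \<noteq> 0" by (auto simp: vec_eq_iff)
    have "hat B $ (i + 1) $ (j + 1) \<noteq> 0"
      using ij twisted_matrix_hat[of B] by (simp add: twisted_matrix_def)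
    then have "l j = l (j + 1)"
      using ij that rel[of m n] \<open>m = 0\<close> by simp
    then show False by (simp add: l_distinct)
  qed
  have "proj_class B \<in> carrier (Aut_curve A) \<longleftrightarrow> pgl_act (proj_class B) ` curve A = curve A"
  proof
    assume "proj_class B \<in> carrier (Aut_curve A)"
    then show "pgl_act (proj_class B) ` curve A = curve A" by (auto simp: carrier_Aut_curve)
  qed (use B in \<open>auto simp: carrier_Aut_curve\<close>)
  also have "\<dots> \<longleftrightarrow> curve ?M = curve A" by (simp only: pgl_act_curve[OF C])
  also have "\<dots> \<longleftrightarrow> (\<exists>m n. ?M = map_matrix ((*) m) A + mat n)"
    using curve_subset_imp_affine[of ?M] curve_affine m0 by (metis order_refl)
  finally show ?thesis unfolding rel .
qed

text \<open>An invertible matrix has a nonzero entry, at \<open>(a, b)\<close> say. Frobenius invariance moves it along the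
  cyclic diagonal through \<open>(a, b)\<close>, and because the eigenvalues are distinct, the relation leaves
  no room for nonzero entries elsewhere.\<close>

lemma proj_class_in_Aut_iff:
  assumes B: "invertible B"
  shows "proj_class B \<in> carrier (Aut_curve A) \<longleftrightarrow> (\<exists>k. monomial k (hat B) \<and> affine_shift k)"
proof
  assume "proj_class B \<in> carrier (Aut_curve A)"
  then obtain m n where mn: "\<And>i j. hat B $ i $ j \<noteq> 0 \<Longrightarrow> l j = to_ac m * l i + to_ac n"
    using proj_class_in_Aut_iff_relation[OF B] by blast
  have "det (hat B) \<noteq> 0" using B by (simp add: det_hat invertible_det_nz)
  then have "hat B \<noteq> 0" by (auto simp: det_3)
  then obtain a b where ab: "hat B $ a $ b \<noteq> 0" by (auto simp: vec_eq_iff)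
  define k where "k = b - a"
  have nz: "hat B $ i $ (i + k) \<noteq> 0" for i
  proof (rule index_3_cycle[of "\<lambda>i. hat B $ i $ (i + k) \<noteq> 0" a])
    show "hat B $ a $ (a + k) \<noteq> 0" using ab by (simp add: k_def)
    fix i assume "hat B $ i $ (i + k) \<noteq> 0"
    then have "hat B $ (i + 1) $ (i + k + 1) \<noteq> 0"
      using twisted_matrix_hat[of B] unfolding twisted_matrix_def by simp
    then show "hat B $ (i + 1) $ (i + 1 + k) \<noteq> 0" by (simp add: add_ac)
  qed
  have "j = i + k" if "hat B $ i $ j \<noteq> 0" for i j
    using mn[OF that] mn[OF nz[of i]] l_distinct by metis
  then have "monomial k (hat B)" using nz by (auto simp: monomial_def)
  moreover have "affine_shift k" unfolding affine_shift_def using mn[OF nz] by blast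
  ultimately show "\<exists>k. monomial k (hat B) \<and> affine_shift k" by blast
next
  assume "\<exists>k. monomial k (hat B) \<and> affine_shift k"
  then show "proj_class B \<in> carrier (Aut_curve A)"
    unfolding proj_class_in_Aut_iff_relation[OF B] affine_shift_def monomial_def by metis
qed

text \<open>Meaningful only where \<open>Y\<close> is invariant under the Frobenius; elsewhere its value is arbitrary.\<close>

definition unhat :: "'a alg_closure ^ 3 ^ 3 \<Rightarrow> 'a ^ 3 ^ 3" where
  "unhat Y = (SOME B. hat B = Y)"

lemma hat_unhat: "twisted_matrix Y \<Longrightarrow> hat (unhat Y) = Y"
  unfolding unhat_def by (rule someI_ex) (auto elim: twisted_matrix_imp_hat)

lemma twisted_diag: "(\<And>i. d (i + 1) = d i ^ CARD('a)) \<Longrightarrow> twisted_matrix (diag d)"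
  by (simp add: twisted_matrix_def diag_nth)

lemma invertible_if_monomial_hat:
  assumes "monomial k (hat B)" shows "invertible B"
proof -
  have nz: "hat B $ i $ (i + k) \<noteq> 0" and z: "j \<noteq> i + k \<Longrightarrow> hat B $ i $ j = 0" for i j
    using assms unfolding monomial_def by auto
  define R where "R = (\<chi> i j. if i = j + k then inverse (hat B $ j $ i) else 0)"
  have "(hat B ** R) $ i $ j = (mat 1 :: 'a alg_closure ^ 3 ^ 3) $ i $ j" for i j
  proof -
    have "(hat B ** R) $ i $ j = (\<Sum>m\<in>UNIV. if m = i + k then hat B $ i $ m * R $ m $ j else 0)"
      unfolding matrix_matrix_mult_def vec_lambda_beta by (intro sum.cong refl) (use z in auto)
    then show ?thesis using nz[of j] by (simp add: R_def mat_def)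
  qed
  then have "hat B ** R = mat 1" by (simp add: vec_eq_iff)
  then have "invertible (hat B)" by (metis invertible_right_inverse)
  then show ?thesis by (simp add: invertible_hat)
qed

text \<open>The rotation of the eigenlines induced by an automorphism. It is the same for all representatives,
  as scaling does not change which entries vanish.\<close>

definition shift_of :: "('a ^ 3 ^ 3) set \<Rightarrow> 3" where
  "shift_of S = (THE k. \<exists>B\<in>S. monomial k (hat B))"

lemma shift_of_proj_class:
  assumes "monomial k (hat B)"
  shows "shift_of (proj_class B) = k"
  unfolding shift_of_def
proof (rule the_equality)
  show "\<exists>B\<in>proj_class B. monomial k (hat B)" using assms proj_class_self by blast
  fix k' assume "\<exists>C\<in>proj_class B. monomial k' (hat C)"
  then obtain c where "c \<noteq> 0" "monomial k' (hat (mat c ** B))" by (auto simp: proj_class_def)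
  then have "monomial k' (hat B)" by (simp add: hat_mult hat_mat monomial_scale)
  then show "k' = k" using assms monomial_unique by blast
qed

definition Z3 :: "3 monoid" where
  "Z3 = \<lparr>carrier = UNIV, monoid.mult = (+), one = 0\<rparr>"

lemma group_Z3: "group Z3"
proof (rule groupI)
  fix i assume "i \<in> carrier Z3"
  show "\<exists>j\<in>carrier Z3. j \<otimes>\<^bsub>Z3\<^esub> i = \<one>\<^bsub>Z3\<^esub>"
    by (intro bexI[of _ "- i"]) (simp_all add: Z3_def)
qed (simp_all add: Z3_def add.assoc)

lemma Aut_elem:
  assumes "S \<in> carrier (Aut_curve A)"
  obtains B k where "S = proj_class B" "invertible B" "monomial k (hat B)" "affine_shift k"
    "shift_of S = k"
proof -
  obtain B where B: "S = proj_class B" "invertible B" using assms by (auto simp: carrier_Aut_curve)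
  then obtain k where "monomial k (hat B)" "affine_shift k"
    using assms proj_class_in_Aut_iff by blast
  then show ?thesis using that B shift_of_proj_class by blast
qed

lemma shift_of_hom: "group_hom (Aut_curve A) Z3 shift_of"
proof (intro group_hom.intro group_hom_axioms.intro group_Aut_curve group_Z3 homI)
  fix S S' assume S: "S \<in> carrier (Aut_curve A)" and S': "S' \<in> carrier (Aut_curve A)"
  obtain B k where B: "S = proj_class B" "invertible B" "monomial k (hat B)" "shift_of S = k"
    using S by (rule Aut_elem)
  obtain B' k' where B': "S' = proj_class B'" "invertible B'" "monomial k' (hat B')" "shift_of S' = k'"
    using S' by (rule Aut_elem)
  have "monomial (k + k') (hat (B ** B'))" using B B' by (simp add: hat_mult monomial_mult)
  then show "shift_of (S \<otimes>\<^bsub>Aut_curve A\<^esub> S') = shift_of S \<otimes>\<^bsub>Z3\<^esub> shift_of S'"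
    using B B' by (simp add: mult_Aut_curve proj_class_mult shift_of_proj_class Z3_def)
qed (simp add: Z3_def)

text \<open>Every rotation that an affine map induces on the eigenvalues occurs: its permutation matrix is
  invariant under the Frobenius, hence comes from a matrix over \<open>\<F>\<^sub>q\<close>.\<close>

lemma shift_image: "shift_of ` carrier (Aut_curve A) = {k. affine_shift k}"
proof
  show "shift_of ` carrier (Aut_curve A) \<subseteq> {k. affine_shift k}" by (auto elim: Aut_elem)
  show "{k. affine_shift k} \<subseteq> shift_of ` carrier (Aut_curve A)"
  proof
    fix k assume "k \<in> {k. affine_shift k}"
    then have k: "affine_shift k" by simp
    define Y :: "'a alg_closure ^ 3 ^ 3" where "Y = (\<chi> i j. if j = i + k then 1 else 0)"
    have "twisted_matrix Y"
      unfolding twisted_matrix_def Y_def by (auto simp: add_ac zero_power)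
    then have "hat (unhat Y) = Y" by (rule hat_unhat)
    moreover have "monomial k Y" by (simp add: monomial_def Y_def)
    ultimately have mono: "monomial k (hat (unhat Y))" by simp
    then have "invertible (unhat Y)" by (rule invertible_if_monomial_hat)
    then have "proj_class (unhat Y) \<in> carrier (Aut_curve A)"
      using mono k proj_class_in_Aut_iff by blast
    then show "k \<in> shift_of ` carrier (Aut_curve A)"
      using shift_of_proj_class[OF mono] by blast
  qed
qed

section \<open>The cyclic kernel\<close>

text \<open>The conjugates of \<open>x\<close>, in the cyclic order in which \<open>l\<close> lists the eigenvalues.\<close>

definition conj3 :: "'a alg_closure \<Rightarrow> 3 \<Rightarrow> 'a alg_closure" where
  "conj3 x i = (if i = 1 then x else if i = 2 then x ^ CARD('a) else (x ^ CARD('a)) ^ CARD('a))"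

lemma pow_CARD_3: "x ^ (CARD('a) ^ 3) = ((x ^ CARD('a)) ^ CARD('a)) ^ CARD('a)" for x :: "'a alg_closure"
  by (simp add: power3_eq_cube flip: power_mult)

lemma conj3_Suc:
  assumes "x ^ (CARD('a) ^ 3) = x"
  shows "conj3 x (i + 1) = conj3 x i ^ CARD('a)"
proof -
  have "\<forall>i. conj3 x (i + 1) = conj3 x i ^ CARD('a)"
    unfolding forall_3 cyclic_index_3 using assms by (simp add: conj3_def pow_CARD_3)
  then show ?thesis by blast
qed

lemma orbit_eqI:
  fixes d e :: "3 \<Rightarrow> 'a alg_closure"
  assumes "\<And>i. d (i + 1) = d i ^ CARD('a)" "\<And>i. e (i + 1) = e i ^ CARD('a)" "d 1 = e 1"
  shows "d = e"
proof
  show "d i = e i" for i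
    by (rule index_3_cycle[of "\<lambda>i. d i = e i" 1]) (simp_all add: assms)
qed

text \<open>Any two of the three indices are cyclic neighbours, so it suffices that the Frobenius has no fixed
  point on the orbit.\<close>

lemma orbit_inj_iff:
  fixes d :: "3 \<Rightarrow> 'a alg_closure"
  assumes d: "\<And>i. d (i + 1) = d i ^ CARD('a)"
  shows "inj d \<longleftrightarrow> d 1 \<notin> range to_ac"
proof -
  have step: "d i \<noteq> d (i + 1)" if "d 1 \<notin> range to_ac" for i
  proof (rule index_3_cycle[of "\<lambda>i. d i \<noteq> d (i + 1)" 1])
    show "d 1 \<noteq> d (1 + 1)" using that unfolding d by (metis frob_fixed_iff)
    fix k assume "d k \<noteq> d (k + 1)"
    then show "d (k + 1) \<noteq> d (k + 1 + 1)" by (simp only: d[of "k + 1"] d[of k] frob_inj not_False_eq_True)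
  qed
  have adj: "\<forall>i j :: 3. j = i \<or> j = i + 1 \<or> i = j + 1"
    unfolding forall_3 cyclic_index_3 by simp
  show ?thesis
  proof
    assume "inj d"
    then have "d 1 \<noteq> d (1 + 1)" by (simp add: inj_eq)
    then show "d 1 \<notin> range to_ac" unfolding d by (metis frob_fixed_iff)
  next
    assume "d 1 \<notin> range to_ac"
    then show "inj d" using step adj by (metis injI)
  qed
qed

text \<open>The diagonal matrices \<open>D n\<close> with the conjugates of \<open>x\<^sup>n\<close> as entries, \<open>x\<close> a primitive element of the
  cubic extension, exhaust the kernel. The class of \<open>D n\<close> is trivial if and only if \<open>x\<^sup>n\<close> is in
  \<open>\<F>\<^sub>q\<close>, which means that \<open>q\<^sup>3 - 1\<close> divides \<open>n (q - 1)\<close>.\<close>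

lemma kernel_generator:
  obtains B where
    "proj_class B \<in> carrier (Aut_curve A)"
    "generate (Aut_curve A) {proj_class B} = kernel (Aut_curve A) Z3 shift_of"
    "card (generate (Aut_curve A) {proj_class B}) = CARD('a)\<^sup>2 + CARD('a) + 1"
    "\<And>s::nat. 1 \<le> s \<Longrightarrow> s < CARD('a)\<^sup>2 + CARD('a) + 1 \<Longrightarrow>
      \<exists>C d. proj_class B [^]\<^bsub>Aut_curve A\<^esub> s = proj_class C \<and> hat C = diag d \<and> inj d \<and> (\<forall>i. d i \<noteq> 0)"
proof -
  let ?q = "CARD('a)" and ?G = "Aut_curve A"
  interpret G: group ?G by (rule group_Aut_curve)
  interpret shift: group_hom ?G Z3 shift_of by (rule shift_of_hom)
  obtain x :: "'a alg_closure" where x: "x \<noteq> 0" "x ^ (?q ^ 3) = x"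
    and gen: "\<forall>y. y \<noteq> 0 \<longrightarrow> y ^ (?q ^ 3) = y \<longrightarrow> (\<exists>n. y = x ^ n)"
    and ord_x: "\<forall>n. x ^ n = 1 \<longleftrightarrow> ?q ^ 3 - 1 dvd n"
    by (rule primitive_element)
  define g where "g = conj3 x"
  have g1: "g 1 = x" by (simp add: g_def conj3_def)
  have g_Suc: "g (i + 1) = g i ^ ?q" for i unfolding g_def by (rule conj3_Suc[OF x(2)])
  have g0: "g i \<noteq> 0" for i
    by (rule index_3_cycle[of "\<lambda>i. g i \<noteq> 0" 1]) (use x g1 g_Suc in auto)
  have gn_Suc: "g (i + 1) ^ n = (g i ^ n) ^ ?q" for i n
    unfolding g_Suc by (simp add: mult.commute flip: power_mult)
  define D where "D n = unhat (diag (\<lambda>i. g i ^ n))" for n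
  have hat_D: "hat (D n) = diag (\<lambda>i. g i ^ n)" for n
    unfolding D_def by (intro hat_unhat twisted_diag) (rule gn_Suc)
  have mono_D: "monomial 0 (hat (D n))" for n
    unfolding hat_D monomial_diag using g0 by simp
  have inv_D: "invertible (D n)" for n using mono_D by (rule invertible_if_monomial_hat)
  have Aut_D: "proj_class (D n) \<in> carrier ?G" for n
    using proj_class_in_Aut_iff[OF inv_D] mono_D affine_shift_0 by blast
  define b where "b = proj_class (D 1)"
  have b: "b \<in> carrier ?G" unfolding b_def by (rule Aut_D)
  have D_mult: "D m ** D n = D (m + n)" for m n
    unfolding hat_inj[symmetric] hat_mult hat_D by (simp add: diag_mult_diag power_add)
  have pow: "b [^]\<^bsub>?G\<^esub> n = proj_class (D n)" for n :: nat
  proof (induction n)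
    case 0
    have "D 0 = mat 1" unfolding hat_inj[symmetric] hat_D hat_mat by (simp add: mat_eq_diag)
    then show ?case by (simp add: one_Aut_curve one_PGL3)
  next
    case (Suc n)
    then show ?case
      using inv_D by (simp add: mult_Aut_curve b_def proj_class_mult D_mult)
  qed
  have q: "?q > 1" by (rule CARD_finite_field_gt_1)
  have factor: "?q ^ 3 - 1 = (?q\<^sup>2 + ?q + 1) * (?q - 1)"
    using q by (cases ?q) (simp_all add: power2_eq_square power3_eq_cube algebra_simps)
  have rational: "x ^ n \<in> range to_ac \<longleftrightarrow> ?q\<^sup>2 + ?q + 1 dvd n" for n
  proof -
    have "x ^ n \<in> range to_ac \<longleftrightarrow> (x ^ n) ^ ?q = x ^ n" by (rule frob_fixed_iff[symmetric])
    also have "(x ^ n) ^ ?q = x ^ (n * (?q - 1)) * x ^ n"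
      using q by (simp add: algebra_simps flip: power_mult power_add)
    also have "\<dots> = x ^ n \<longleftrightarrow> x ^ (n * (?q - 1)) = 1" using x(1) by simp
    also have "\<dots> \<longleftrightarrow> ?q\<^sup>2 + ?q + 1 dvd n"
      unfolding ord_x[rule_format] factor using q by (subst dvd_times_right_cancel_iff) auto
    finally show ?thesis .
  qed
  have pow_one: "b [^]\<^bsub>?G\<^esub> n = \<one>\<^bsub>?G\<^esub> \<longleftrightarrow> ?q\<^sup>2 + ?q + 1 dvd n" for n :: nat
  proof -
    have "b [^]\<^bsub>?G\<^esub> n = \<one>\<^bsub>?G\<^esub> \<longleftrightarrow> (\<exists>c. c \<noteq> 0 \<and> D n = mat c)"
      unfolding pow one_Aut_curve one_PGL3
      by (metis proj_class_eqD proj_class_scale matrix_mul_rid)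
    also have "\<dots> \<longleftrightarrow> (\<exists>c. c \<noteq> 0 \<and> (\<lambda>i. g i ^ n) = (\<lambda>_. to_ac c))"
      unfolding hat_inj[symmetric] hat_D hat_mat unfolding mat_eq_diag diag_eq_iff ..
    also have "\<dots> \<longleftrightarrow> x ^ n \<in> range to_ac"
    proof
      assume "x ^ n \<in> range to_ac"
      then obtain c where c: "x ^ n = to_ac c" by auto
      then have "c \<noteq> 0" using x(1) by auto
      moreover have "(\<lambda>i. g i ^ n) = (\<lambda>_. to_ac c)"
        by (rule orbit_eqI) (simp_all add: gn_Suc g1 c frob_to_ac)
      ultimately show "\<exists>c. c \<noteq> 0 \<and> (\<lambda>i. g i ^ n) = (\<lambda>_. to_ac c)" by blast
    qed (metis g1 rangeI)
    finally show ?thesis unfolding rational .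
  qed
  have "G.ord b = ?q\<^sup>2 + ?q + 1"
    by (metis G.pow_eq_id[OF b] pow_one dvd_antisym dvd_refl)
  then have card: "card (generate ?G {b}) = ?q\<^sup>2 + ?q + 1"
    using G.generate_pow_card[OF b] by simp
  have ker: "generate ?G {b} = kernel ?G Z3 shift_of"
  proof
    have "b \<in> kernel ?G Z3 shift_of"
      using b shift_of_proj_class[OF mono_D] by (simp add: kernel_def Z3_def b_def)
    then show "generate ?G {b} \<subseteq> kernel ?G Z3 shift_of"
      by (intro G.generate_subgroup_incl shift.subgroup_kernel) simp
    show "kernel ?G Z3 shift_of \<subseteq> generate ?G {b}"
    proof
      fix S assume "S \<in> kernel ?G Z3 shift_of"
      then have S: "S \<in> carrier ?G" "shift_of S = 0" by (simp_all add: kernel_def Z3_def)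
      obtain B k where B: "S = proj_class B" "monomial k (hat B)" "shift_of S = k"
        using S(1) by (rule Aut_elem)
      then have mono: "monomial 0 (hat B)" using S(2) by simp
      define d where "d = (\<lambda>i. hat B $ i $ i)"
      have hat_B: "hat B = diag d" unfolding d_def by (rule monomial_0_diag[OF mono])
      have d0: "d i \<noteq> 0" for i unfolding d_def by (rule monomial_0_diag[OF mono])
      have d_Suc: "d (i + 1) = d i ^ ?q" for i
        using twisted_matrix_hat[of B] unfolding d_def twisted_matrix_def by blast
      have "d 1 ^ (?q ^ 3) = d (1 + 1 + 1 + 1)" by (simp only: pow_CARD_3 d_Suc)
      then have "d 1 ^ (?q ^ 3) = d 1" unfolding cyclic_index_3 .
      then obtain n where "d 1 = x ^ n" using gen d0 by blast
      then have "d = (\<lambda>i. g i ^ n)"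
        by (intro orbit_eqI d_Suc gn_Suc) (simp add: g1)
      then have "B = D n" unfolding hat_inj[symmetric] hat_B hat_D by simp
      then have "S = b [^]\<^bsub>?G\<^esub> int n" by (simp add: B pow int_pow_int)
      then show "S \<in> generate ?G {b}" unfolding G.generate_pow[OF b] by blast
    qed
  qed
  show ?thesis
  proof (rule that[of "D 1"])
    fix s :: nat assume s: "1 \<le> s" "s < ?q\<^sup>2 + ?q + 1"
    have "\<not> ?q\<^sup>2 + ?q + 1 dvd s" using s by (auto dest: dvd_imp_le)
    then have "(\<lambda>i. g i ^ s) 1 \<notin> range to_ac" using rational[of s] by (simp add: g1)
    then have "inj (\<lambda>i. g i ^ s)" by (subst orbit_inj_iff) (simp_all add: gn_Suc)
    then show "\<exists>C d. proj_class (D 1) [^]\<^bsub>?G\<^esub> s = proj_class C \<and> hat C = diag d \<and> inj d \<and> (\<forall>i. d i \<noteq> 0)"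
      using pow[of s] hat_D[of s] g0 unfolding b_def
      by (intro exI[of _ "D s"] exI[of _ "\<lambda>i. g i ^ s"]) simp
  qed (use b ker card in \<open>simp_all add: b_def\<close>)
qed

end

section \<open>Fixed points\<close>

lemma diag_eigenvector_axis:
  fixes d :: "'n::finite \<Rightarrow> 'k::field"
  assumes "inj d" "diag d *v x = c *s x" "x \<noteq> 0"
  obtains j where "c = d j" "x $ j \<noteq> 0" "\<And>i. i \<noteq> j \<Longrightarrow> x $ i = 0"
proof -
  have e: "d i * x $ i = c * x $ i" for i
    using assms(2) by (simp add: vec_eq_iff diag_mult_vec)
  obtain j where j: "x $ j \<noteq> 0" using assms(3) by (auto simp: vec_eq_iff)
  then have "c = d j" using e[of j] by simp
  moreover have "x $ i = 0" if "i \<noteq> j" for i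
    using e[of i] that assms(1) by (auto simp: \<open>c = d j\<close> inj_eq)
  ultimately show ?thesis using that j by blast
qed

lemma index_3_exhaust_distinct:
  fixes a b c i :: 3
  assumes "a \<noteq> b" "a \<noteq> c" "b \<noteq> c"
  shows "i = a \<or> i = b \<or> i = c"
proof -
  have "card {a, b, c} = CARD(3)" using assms by simp
  then have "{a, b, c} = UNIV" by (intro card_subset_eq) simp_all
  then show ?thesis by blast
qed

context frobenius_eigenbasis
begin

text \<open>For diagonal matrices with distinct entries the eigenvectors are the multiples of the unit vectors.
  So \<open>C\<close> and \<open>T\<close> have the same eigenlines.\<close>

lemma fixed_points_eigenvectors:
  assumes C: "hat C = diag d" "inj d" "\<And>i. d i \<noteq> 0"
    and L: "eigenvector (transpose (map_matrix to_ac A)) L0 c0"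
      "eigenvector (transpose (map_matrix to_ac A)) L1 c1"
      "eigenvector (transpose (map_matrix to_ac A)) L2 c2"
    and c: "c0 \<noteq> c1" "c0 \<noteq> c2" "c1 \<noteq> c2"
  shows "fixed_points (proj_class C) = {proj_point L0, proj_point L1, proj_point L2}"
proof -
  have P0: "P *v v \<noteq> 0" if "v \<noteq> 0" for v
    using that by (metis P_Q_vec(2) matrix_vector_mult_0_right)
  have PC: "diag d *v (P *v v) = P *v (map_matrix to_ac C *v v)" for v
    by (simp add: matrix_vector_mul_assoc flip: C(1) hat_P)
  have axis: "\<exists>j. c = l j \<and> (P *v v) $ j \<noteq> 0 \<and> (\<forall>i. i \<noteq> j \<longrightarrow> (P *v v) $ i = 0)"
    if "eigenvector (transpose (map_matrix to_ac A)) v c" for v c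
  proof -
    have "transpose (map_matrix to_ac A) = map_matrix to_ac (transpose A)"
      by (simp add: vec_eq_iff transpose_def)
    then have v: "v \<noteq> 0" "map_matrix to_ac (transpose A) *v v = c *s v"
      using that by (simp_all add: eigenvector_def)
    have "diag l *v (P *v v) = P *v (map_matrix to_ac (transpose A) *v v)"
      by (simp add: matrix_vector_mul_assoc P_diag)
    then have "diag l *v (P *v v) = c *s (P *v v)" by (simp add: v vector_scalar_commute)
    then show ?thesis using diag_eigenvector_axis[OF inj_l _ P0[OF v(1)]] by metis
  qed
  have fixed: "proj_point v \<in> fixed_points (proj_class C)"
    if v: "v \<noteq> 0" "\<forall>i. i \<noteq> j \<longrightarrow> (P *v v) $ i = 0" for v j
  proof -
    have "diag d *v (P *v v) = d j *s (P *v v)"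
      using v(2) by (auto simp: vec_eq_iff diag_mult_vec)
    then have "Q *v (P *v (map_matrix to_ac C *v v)) = Q *v (d j *s (P *v v))" by (simp only: PC)
    then have "map_matrix to_ac C *v v = d j *s v" by (simp add: P_Q_vec vector_scalar_commute)
    then have "pgl_act (proj_class C) (proj_point v) = proj_point v"
      by (simp add: pgl_act_proj_class proj_point_scale C(3))
    then show ?thesis using v(1) by (auto simp: fixed_points_def proj_plane_def)
  qed
  obtain j0 j1 j2 where j:
    "c0 = l j0" "(P *v L0) $ j0 \<noteq> 0" "\<forall>i. i \<noteq> j0 \<longrightarrow> (P *v L0) $ i = 0"
    "c1 = l j1" "(P *v L1) $ j1 \<noteq> 0" "\<forall>i. i \<noteq> j1 \<longrightarrow> (P *v L1) $ i = 0"
    "c2 = l j2" "(P *v L2) $ j2 \<noteq> 0" "\<forall>i. i \<noteq> j2 \<longrightarrow> (P *v L2) $ i = 0"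
    using axis[OF L(1)] axis[OF L(2)] axis[OF L(3)] by blast
  have "j0 \<noteq> j1" "j0 \<noteq> j2" "j1 \<noteq> j2" using c j by auto
  note all = index_3_exhaust_distinct[OF this]
  have same: "proj_point v = proj_point w"
    if v: "(P *v v) $ j \<noteq> 0" "\<forall>i. i \<noteq> j \<longrightarrow> (P *v v) $ i = 0"
      and w: "(P *v w) $ j \<noteq> 0" "\<forall>i. i \<noteq> j \<longrightarrow> (P *v w) $ i = 0" for v w j
  proof -
    define r where "r = (P *v v) $ j / (P *v w) $ j"
    have "(P *v v) $ i = (r *s (P *v w)) $ i" for i
      using v w by (cases "i = j") (simp_all add: r_def)
    then have "P *v v = r *s (P *v w)" unfolding vec_eq_iff by blast
    then have "Q *v (P *v v) = r *s (Q *v (P *v w))" by (simp add: vector_scalar_commute)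
    then have "v = r *s w" by (simp only: P_Q_vec)
    moreover have "r \<noteq> 0" using v w by (simp add: r_def)
    ultimately show ?thesis using proj_point_scale[of r w] by simp
  qed
  show ?thesis
  proof
    show "{proj_point L0, proj_point L1, proj_point L2} \<subseteq> fixed_points (proj_class C)"
      using fixed j L by (auto simp: eigenvector_def)
    show "fixed_points (proj_class C) \<subseteq> {proj_point L0, proj_point L1, proj_point L2}"
    proof
      fix p assume "p \<in> fixed_points (proj_class C)"
      then obtain v where v: "p = proj_point v" "v \<noteq> 0"
          "proj_point (map_matrix to_ac C *v v) = proj_point v"
        by (auto simp: fixed_points_def proj_plane_def pgl_act_proj_class)
      then obtain e where "map_matrix to_ac C *v v = e *s v" by (blast elim: proj_point_eqD)
      then have "diag d *v (P *v v) = e *s (P *v v)" by (simp add: PC vector_scalar_commute)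
      then obtain i where "(P *v v) $ i \<noteq> 0" "\<forall>k. k \<noteq> i \<longrightarrow> (P *v v) $ k = 0"
        using diag_eigenvector_axis[OF C(2) _ P0[OF v(2)]] by metis
      then show "p \<in> {proj_point L0, proj_point L1, proj_point L2}"
        using all[of i] same j v(1) by blast
    qed
  qed
qed

section \<open>The quotient by the cyclic kernel\<close>

text \<open>The other two instances of the relation are its images under the Frobenius.\<close>

lemma affine_shift_1_iff: "affine_shift 1 \<longleftrightarrow> (\<exists>m n. l 2 = to_ac m * l 1 + to_ac n)"
proof
  assume "affine_shift 1"
  then obtain m n where "\<forall>i. l (i + 1) = to_ac m * l i + to_ac n" unfolding affine_shift_def by blast
  then have "l (1 + 1) = to_ac m * l 1 + to_ac n" by blast
  then show "\<exists>m n. l 2 = to_ac m * l 1 + to_ac n" unfolding cyclic_index_3 by blast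
next
  assume "\<exists>m n. l 2 = to_ac m * l 1 + to_ac n"
  then obtain m n where mn: "l 2 = to_ac m * l 1 + to_ac n" by blast
  have "l (i + 1) = to_ac m * l i + to_ac n" for i
  proof (rule index_3_cycle[of "\<lambda>i. l (i + 1) = to_ac m * l i + to_ac n" 1])
    show "l (1 + 1) = to_ac m * l 1 + to_ac n" unfolding cyclic_index_3 by (rule mn)
    fix k assume "l (k + 1) = to_ac m * l k + to_ac n"
    then have "l (k + 1) ^ CARD('a) = (to_ac m * l k + to_ac n) ^ CARD('a)" by (rule arg_cong)
    then show "l (k + 1 + 1) = to_ac m * l (k + 1) + to_ac n"
      by (simp only: l_Suc frob_add power_mult_distrib frob_to_ac)
  qed
  then show "affine_shift 1" unfolding affine_shift_def by blast
qed

lemma affine_shift_add: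
  assumes "affine_shift j" "affine_shift k"
  shows "affine_shift (j + k)"
proof -
  obtain m n m' n' where j: "\<forall>i. l (i + j) = to_ac m * l i + to_ac n"
      and k: "\<forall>i. l (i + k) = to_ac m' * l i + to_ac n'"
    using assms unfolding affine_shift_def by blast
  have "l (i + (j + k)) = to_ac (m' * m) * l i + to_ac (m' * n + n')" for i
  proof -
    have "l (i + (j + k)) = to_ac m' * (to_ac m * l i + to_ac n) + to_ac n'"
      unfolding add.assoc[symmetric] k[rule_format] j[rule_format] ..
    then show ?thesis by (simp add: algebra_simps)
  qed
  then show ?thesis unfolding affine_shift_def by blast
qed

text \<open>The rotations in question form a subgroup of a group of prime order.\<close>

lemma affine_shift_cases: "{k. affine_shift k} = (if affine_shift 1 then UNIV else {0})"
proof -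
  have "(3::3) = 0" by simp
  then have three: "affine_shift 3" using affine_shift_0 by metis
  have four: "(2::3) + 2 = 1" by simp
  have 2: "affine_shift 1 \<longleftrightarrow> affine_shift 2"
    using affine_shift_add[of 1 1] affine_shift_add[of 2 2, unfolded four] by auto
  show ?thesis
  proof (cases "affine_shift 1")
    case True
    then have "\<forall>k. affine_shift k" unfolding forall_3 using 2 three by blast
    then show ?thesis using True by auto
  next
    case False
    then have "\<forall>k. affine_shift k \<longleftrightarrow> k = 0" unfolding forall_3 using 2 three by simp
    then show ?thesis using False by auto
  qed
qed

lemma Z3_cyclic: "cyclic_group Z3"
proof -
  interpret Z3: group Z3 by (rule group_Z3)
  have pow: "(1::3) [^]\<^bsub>Z3\<^esub> n = of_nat n" for n :: nat
    by (induction n) (simp_all add: Z3_def)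
  have "\<forall>k::3. \<exists>n::nat. k = of_nat n"
    unfolding forall_3 by (intro conjI exI[of _ 1] exI[of _ 2] exI[of _ 3]) simp_all
  then have "k \<in> range (\<lambda>n::int. (1::3) [^]\<^bsub>Z3\<^esub> n)" for k :: 3
    by (metis pow int_pow_int rangeI)
  then have "carrier Z3 = range (\<lambda>n::int. (1::3) [^]\<^bsub>Z3\<^esub> n)"
    by (auto simp: Z3_def)
  then show ?thesis unfolding Z3.cyclic_group by (intro bexI[of _ 1]) (simp_all add: Z3_def)
qed

text \<open>The quotient is isomorphic to the group of rotations that occur, which is trivial or the whole
  group of order three.\<close>

lemma quotient_cases:
  defines "H \<equiv> Aut_curve A Mod kernel (Aut_curve A) Z3 shift_of"
  shows "trivial_group H \<longleftrightarrow> \<not> affine_shift 1"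
    and "affine_shift 1 \<Longrightarrow> cyclic_group H \<and> card (carrier H) = 3"
proof -
  interpret shift: group_hom "Aut_curve A" Z3 shift_of by (rule shift_of_hom)
  interpret H: group H unfolding H_def by (rule normal.factorgroup_is_group[OF shift.normal_kernel])
  have surj: "shift_of ` carrier (Aut_curve A) = (if affine_shift 1 then UNIV else {0})"
    by (simp only: shift_image affine_shift_cases)
  show cyc: "cyclic_group H \<and> card (carrier H) = 3" if "affine_shift 1"
  proof -
    have "H \<cong> Z3" unfolding H_def by (rule shift.FactGroup_iso) (simp add: surj that Z3_def)
    then show ?thesis
      using isomorphic_group_cyclicity[of H Z3] H.is_group group_Z3 Z3_cyclic iso_same_card[of H Z3]
      by (simp add: Z3_def)
  qed
  show "trivial_group H \<longleftrightarrow> \<not> affine_shift 1"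
  proof
    assume "trivial_group H"
    then show "\<not> affine_shift 1" using cyc by (auto simp: trivial_group_def)
  next
    assume "\<not> affine_shift 1"
    then have "kernel (Aut_curve A) Z3 shift_of = carrier (Aut_curve A)"
      using surj by (auto simp: kernel_def Z3_def)
    then have "carrier H = {carrier (Aut_curve A)}"
      unfolding H_def FactGroup_def RCOSETS_def
      using shift.G.coset_join2[OF _ shift.G.subgroup_self] shift.G.one_closed by auto
    then show "trivial_group H" unfolding H.trivial_group by blast
  qed
qed

section \<open>When the quotient is nontrivial\<close>

lemma poly_charpoly_if_hat_diag:
  assumes "hat (transpose M) = diag d"
  shows "poly (map_poly to_ac (charpoly M)) x = (x - d 1) * (x - d 2) * (x - d 3)"
proof -
  have "charpoly M = charpoly (transpose M)" by (simp add: charpoly_3 transpose_def det_3 algebra_simps)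
  then have "poly (map_poly to_ac (charpoly M)) x = det (mat x - map_matrix to_ac (transpose M))"
    by (simp add: poly_charpoly_3)
  also have "\<dots> = det (diag (\<lambda>i. x - d i))"
  proof -
    have "P ** (mat x - map_matrix to_ac (transpose M)) = (mat x - diag d) ** P"
    proof -
      have "P ** map_matrix to_ac (transpose M) = diag d ** P" using hat_P[of "transpose M"] assms by simp
      then have "\<And>i j. (P ** map_matrix to_ac (transpose M)) $ i $ j = (diag d ** P) $ i $ j" by simp
      moreover have "\<And>i j. (P ** mat x) $ i $ j = (mat x ** P) $ i $ j" by (simp add: mat_comm)
      ultimately show ?thesis
        by (simp add: vec_eq_iff matrix_matrix_mult_def left_diff_distrib right_diff_distrib sum_subtractf)
    qed
    then have "det P * det (mat x - map_matrix to_ac (transpose M)) = det (mat x - diag d) * det P"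
      by (simp flip: det_mul)
    moreover have "mat x - diag d = diag (\<lambda>i. x - d i)" by (simp add: vec_eq_iff mat_def diag_nth)
    ultimately show ?thesis using det_P_nz by simp
  qed
  also have "\<dots> = (x - d 1) * (x - d 2) * (x - d 3)"
    by (simp add: det_3 diag_nth index_3_distinct)
  finally show ?thesis .
qed

lemma hat_transpose_affine:
  "hat (transpose (map_matrix ((*) m) A + mat n)) = diag (\<lambda>i. to_ac m * l i + to_ac n)"
proof -
  have "transpose (map_matrix ((*) m) A + mat n) = map_matrix ((*) m) (transpose A) + mat n"
    by (simp add: vec_eq_iff transpose_def mat_def)
  then show ?thesis
    by (simp add: hat_affine hat_transpose_A) (simp add: vec_eq_iff diag_nth mat_def)
qed

lemma charpoly_A_root: "poly (map_poly to_ac (charpoly A)) x = (x - l 1) * (x - l 2) * (x - l 3)"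
  by (rule poly_charpoly_if_hat_diag[OF hat_transpose_A])

lemma depressed_cubic: "monom 1 3 - (smult u (monom 1 1) + [:a:]) = [:- a, - u, 0, 1 :: 'b::comm_ring_1:]"
  by (simp add: numeral_3_eq_3 monom_Suc monom_0)

lemma pure_cubic: "monom 1 3 - [:a:] = [:- a, 0, 0, 1 :: 'b::comm_ring_1:]"
  by (simp add: numeral_3_eq_3 monom_Suc monom_0)

lemma l_irrational: "l i \<notin> range to_ac"
proof
  assume "l i \<in> range to_ac"
  then have "l (i + 1) = l i" unfolding l_Suc frob_fixed_iff .
  then show False by (simp add: l_distinct)
qed

lemma three_eq_0_iff: "(3 :: 'a alg_closure) = 0 \<longleftrightarrow> CHAR('a) = 3"
proof -
  have "(3 :: 'a alg_closure) = 0 \<longleftrightarrow> CHAR('a) dvd 3"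
    using of_nat_eq_0_iff_char_dvd[of 3, where 'a="'a alg_closure"] by simp
  also have "\<dots> \<longleftrightarrow> CHAR('a) = 3"
  proof
    assume "CHAR('a) dvd 3"
    then show "CHAR('a) = 3"
      using primes_dvd_imp_eq[OF prime_CHAR_finite_field[where 'a='a], of 3] by simp
  qed simp
  finally show ?thesis .
qed

text \<open>The three translations by \<open>n\<close> add up to zero, so \<open>3 n = 0\<close> and the characteristic is three. In
  characteristic three \<open>t \<mapsto> t\<^sup>3 - n\<^sup>2 t\<close> is additive with kernel \<open>{0, n, - n}\<close>, whence its value at \<open>l 1\<close> is
  fixed by the Frobenius.\<close>

lemma translation_imp_artin_schreier:
  assumes tr: "l 2 = l 1 + to_ac n"
  shows "(\<exists>e::nat. CARD('a) = 3 ^ e) \<and>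
    (\<exists>\<mu> a. \<mu> \<noteq> 0 \<and> charpoly A = monom 1 3 - (smult (\<mu>\<^sup>2) (monom 1 1) + [:a:]))"
proof -
  have l3: "l 3 = l 2 + to_ac n"
    using arg_cong[OF tr, of "\<lambda>x. x ^ CARD('a)"] by (simp add: frob_add frob_to_ac flip: l_orbit)
  have l1: "l 1 = l 3 + to_ac n"
    using arg_cong[OF l3, of "\<lambda>x. x ^ CARD('a)"] by (simp add: frob_add frob_to_ac flip: l_orbit)
  have n0: "n \<noteq> 0" using tr l_distinct[of 2 1] by auto
  have "l 1 = l 1 + 3 * to_ac n" using l1 unfolding l3 tr by (simp add: algebra_simps)
  then have three: "(3 :: 'a alg_closure) = 0" using n0 by simp
  then have "CHAR('a) = 3" by (simp only: three_eq_0_iff)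
  then have e: "\<exists>e::nat. CARD('a) = 3 ^ e" using CARD_eq_CHAR_power[where 'a='a] by simp
  define b where "b = l 1 ^ 3 - to_ac n ^ 2 * l 1"
  have pow: "(x ^ k) ^ CARD('a) = (x ^ CARD('a)) ^ k" for x :: "'a alg_closure" and k
    by (simp add: mult.commute flip: power_mult)
  have "b ^ CARD('a) = l 2 ^ 3 - to_ac n ^ 2 * l 2"
    unfolding b_def frob_diff power_mult_distrib pow frob_to_ac l_orbit(1)[symmetric] ..
  also have "\<dots> = b + 3 * (l 1 * to_ac n * (l 1 + to_ac n))"
    unfolding tr b_def by (simp add: power2_eq_square power3_eq_cube algebra_simps)
  finally have "b ^ CARD('a) = b" using three by simp
  then obtain a where a: "b = to_ac a" unfolding frob_fixed_iff by blast
  have "charpoly A = [:- a, - n\<^sup>2, 0, 1:]"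
  proof (rule cubic_unique[OF degree_charpoly_3 monic_charpoly_3 _ _ inj_l l_Suc])
    show "poly (map_poly to_ac (charpoly A)) (l 1) = 0" by (simp add: charpoly_A_root)
    show "poly (map_poly to_ac [:- a, - n\<^sup>2, 0, 1:]) (l 1) = 0"
      using a by (simp add: map_poly_pCons b_def power2_eq_square power3_eq_cube algebra_simps)
  qed (simp_all add: numeral_3_eq_3)
  then show ?thesis using e n0 unfolding depressed_cubic by blast
qed

text \<open>Going around the orbit multiplies the difference of two eigenvalues by \<open>m\<^sup>3\<close>, hence \<open>m\<^sup>3 = 1\<close>, and a
  cube root of unity other than 1 exists in \<open>\<F>\<^sub>q\<close> only for \<open>q \<equiv> 1\<close> modulo 3. After subtraction
  of the fixed point \<open>c\<close> of the affine map, the Frobenius multiplies the eigenvalues by \<open>m\<close>, so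
  their common cube is in \<open>\<F>\<^sub>q\<close>.\<close>

lemma homothety_imp_pure_cubic:
  assumes tr: "l 2 = to_ac m * l 1 + to_ac n" and m: "m \<noteq> 1"
  shows "[CARD('a) = 1] (mod 3) \<and>
    (\<exists>A' a. invertible A' \<and> charpoly A' = monom 1 3 - [:a:] \<and> curve A = curve A')"
proof -
  have l3: "l 3 = to_ac m * l 2 + to_ac n"
    using arg_cong[OF tr, of "\<lambda>x. x ^ CARD('a)"]
    by (simp add: frob_add frob_to_ac power_mult_distrib flip: l_orbit)
  have l1: "l 1 = to_ac m * l 3 + to_ac n"
    using arg_cong[OF l3, of "\<lambda>x. x ^ CARD('a)"]
    by (simp add: frob_add frob_to_ac power_mult_distrib flip: l_orbit)
  have d12: "l 1 - l 2 = to_ac m * (l 3 - l 1)" using l1 tr by (simp add: algebra_simps)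
  have d31: "l 3 - l 1 = to_ac m * (l 2 - l 3)" using l1 l3 by (simp add: algebra_simps)
  have d23: "l 2 - l 3 = to_ac m * (l 1 - l 2)" using l3 tr by (simp add: algebra_simps)
  have "(to_ac m ^ 3 - 1) * (l 1 - l 2) = 0"
    using d12 unfolding d31 d23 by (simp add: power3_eq_cube algebra_simps)
  then have "to_ac (m ^ 3) = to_ac 1" using l_distinct[of 1 2] by simp
  then have m3: "m ^ 3 = 1" by (simp only: to_ac_eq_iff)
  then have m0: "m \<noteq> 0" by auto
  have "m ^ (CARD('a) mod 3) = m"
  proof -
    have "m = m ^ (3 * (CARD('a) div 3) + CARD('a) mod 3)"
      by (simp add: finite_field_power_CARD)
    also have "\<dots> = m ^ (CARD('a) mod 3)" unfolding power_add power_mult m3 by simp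
    finally show ?thesis ..
  qed
  moreover have "CARD('a) mod 3 < 3" by simp
  then have "CARD('a) mod 3 = 0 \<or> CARD('a) mod 3 = 1 \<or> CARD('a) mod 3 = 2" by linarith
  ultimately have "CARD('a) mod 3 = 1" using m m0 by (auto simp: power2_eq_square)
  then have q: "[CARD('a) = 1] (mod 3)" by (simp add: cong_def)
  define c where "c = n / (1 - m)"
  define A' where "A' = map_matrix ((*) 1) A + mat (- c)"
  have hat: "hat (transpose A') = diag (\<lambda>i. l i - to_ac c)"
    unfolding A'_def hat_transpose_affine by simp
  have shift: "l 2 - to_ac c = to_ac m * (l 1 - to_ac c)"
  proof -
    have "n = c * (1 - m)" using m by (simp add: c_def)
    then have "to_ac n = to_ac c * (1 - to_ac m)" by (metis to_ac_1 to_ac_diff to_ac_mult)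
    then show ?thesis unfolding tr by (simp add: algebra_simps)
  qed
  define l' where "l' i = l i - to_ac c" for i
  have l': "inj l'" "l' (i + 1) = l' i ^ CARD('a)" for i
    using inj_l by (auto simp: l'_def inj_def l_Suc frob_diff frob_to_ac)
  have "(l' 1 ^ 3) ^ CARD('a) = l' 2 ^ 3"
    using l'(2)[of 1] unfolding cyclic_index_3 by (simp add: mult.commute flip: power_mult)
  also have "\<dots> = l' 1 ^ 3" using shift m3
    by (simp add: l'_def power_mult_distrib flip: to_ac_power)
  finally obtain a where a: "l' 1 ^ 3 = to_ac a" unfolding frob_fixed_iff by blast
  have "charpoly A' = [:- a, 0, 0, 1:]"
  proof (rule cubic_unique[OF degree_charpoly_3 monic_charpoly_3 _ _ l'])
    show "poly (map_poly to_ac (charpoly A')) (l' 1) = 0"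
      by (simp add: poly_charpoly_if_hat_diag[OF hat] l'_def)
    show "poly (map_poly to_ac [:- a, 0, 0, 1:]) (l' 1) = 0"
      using a by (simp add: map_poly_pCons power3_eq_cube mult.assoc)
  qed (simp_all add: numeral_3_eq_3)
  moreover have "invertible (transpose A')"
  proof (rule invertible_if_monomial_hat)
    show "monomial 0 (hat (transpose A'))"
      unfolding hat monomial_diag using l_irrational by (metis eq_iff_diff_eq_0 rangeI)
  qed
  then have "invertible A'" by (simp add: invertible_det_nz)
  moreover have "curve A = curve A'" unfolding A'_def by (subst curve_affine) simp_all
  ultimately show ?thesis using q unfolding pure_cubic by blast
qed

text \<open>The matrix is \<open>A' = m A + n E\<close>, so \<open>y = m \<lambda> + n\<close> is a root of \<open>t\<^sup>3 - a\<close>. With \<open>q = 3 t + 1\<close> this yields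
  \<open>y\<^sup>q = a\<^sup>t y\<close>, which is linear in \<open>y\<close>.\<close>

lemma pure_cubic_imp_affine_shift:
  assumes q: "[CARD('a) = 1] (mod 3)"
    and A': "invertible A'" "charpoly A' = monom 1 3 - [:a:]" "curve A = curve A'"
  shows "affine_shift 1"
proof -
  obtain m n where mn: "A' = map_matrix ((*) m) A + mat n"
    using curve_subset_imp_affine[of A'] A'(3) by auto
  have m0: "m \<noteq> 0"
  proof
    assume "m = 0"
    then have A'_n: "A' = mat n" by (simp add: mn vec_eq_iff mat_def)
    have "coeff (charpoly A') 2 = - (3 * n)" unfolding A'_n by (simp add: charpoly_3 mat_def numeral_2_eq_2)
    moreover have "coeff (charpoly A') 2 = 0" unfolding A'(2) pure_cubic by (simp add: numeral_2_eq_2)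
    ultimately have "(3::'a) * n = 0" by simp
    then have "to_ac ((3::'a) * n) = 0" by (simp only: to_ac_0)
    moreover have "CHAR('a) \<noteq> 3"
    proof
      assume "CHAR('a) = 3"
      then have "3 dvd CARD('a)" using CHAR_dvd_CARD_finite_field[where 'a='a] by simp
      then show False using q by (auto simp: cong_def)
    qed
    ultimately have "n = 0" by (simp flip: three_eq_0_iff)
    then show False using A'(1) by (simp add: A'_n invertible_det_nz det_3 mat_def)
  qed
  define y where "y i = to_ac m * l i + to_ac n" for i
  have "poly (map_poly to_ac (charpoly A')) (y 1) = 0"
    using poly_charpoly_if_hat_diag[OF hat_transpose_affine[of m n]] unfolding mn y_def by simp
  then have y3: "y 1 ^ 3 = to_ac a"
    unfolding A'(2) pure_cubic by (simp add: map_poly_pCons power3_eq_cube mult.assoc)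
  define t where "t = CARD('a) div 3"
  have "CARD('a) mod 3 = 1" using q by (simp add: cong_def)
  then have t: "CARD('a) = 3 * t + 1" unfolding t_def by presburger
  have "y 2 = y 1 ^ CARD('a)"
    by (simp add: y_def l_orbit(1) frob_add power_mult_distrib frob_to_ac)
  also have "\<dots> = to_ac a ^ t * y 1" unfolding t power_add power_mult y3 by simp
  finally have "to_ac m * l 2 = to_ac (a ^ t) * (to_ac m * l 1 + to_ac n) - to_ac n"
    by (simp add: y_def algebra_simps)
  then have "l 2 = to_ac (a ^ t) * l 1 + to_ac ((a ^ t * n - n) / m)"
    using m0 by (simp add: field_simps)
  then show ?thesis unfolding affine_shift_1_iff by blast
qed

text \<open>In characteristic three \<open>\<lambda> + \<mu>\<close> is a root along with \<open>\<lambda>\<close>, so it is one of the other two conjugates.\<close>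

lemma artin_schreier_imp_affine_shift:
  assumes q: "CARD('a) = 3 ^ e"
    and f: "\<mu> \<noteq> 0" "charpoly A = monom 1 3 - (smult (\<mu>\<^sup>2) (monom 1 1) + [:a:])"
  shows "affine_shift 1"
proof -
  have "CHAR('a) dvd 3 ^ e" using CHAR_dvd_CARD_finite_field[where 'a='a] q by simp
  then have "CHAR('a) dvd 3" using prime_CHAR_finite_field[where 'a='a] prime_dvd_power by blast
  then have three: "(3 :: 'a alg_closure) = 0"
    using of_nat_eq_0_iff_char_dvd[of 3, where 'a="'a alg_closure"] by simp
  have val: "poly (map_poly to_ac (charpoly A)) x = x ^ 3 - to_ac \<mu> ^ 2 * x - to_ac a" for x
    unfolding f(2) depressed_cubic by (simp add: map_poly_pCons power2_eq_square power3_eq_cube algebra_simps)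
  let ?y = "l 1 + to_ac \<mu>"
  have "poly (map_poly to_ac (charpoly A)) (l 1) = 0" by (simp add: charpoly_A_root)
  moreover have "poly (map_poly to_ac (charpoly A)) ?y
      = poly (map_poly to_ac (charpoly A)) (l 1) + 3 * (l 1 * to_ac \<mu> * ?y)"
    unfolding val by (simp add: power2_eq_square power3_eq_cube algebra_simps)
  ultimately have "poly (map_poly to_ac (charpoly A)) ?y = 0" using three by simp
  then have "?y = l 2 \<or> ?y = l 3" using f(1) unfolding charpoly_A_root by auto
  then show ?thesis
  proof
    assume "?y = l 2"
    then have "l 2 = to_ac 1 * l 1 + to_ac \<mu>" by simp
    then show ?thesis unfolding affine_shift_1_iff by blast
  next
    assume "?y = l 3"
    then have "?y ^ CARD('a) = l 1" by (simp add: l_orbit(3)[symmetric])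
    then have "l 2 + to_ac \<mu> = l 1" by (simp add: frob_add frob_to_ac flip: l_orbit(1))
    then have "l 2 = to_ac 1 * l 1 + to_ac (- \<mu>)" by (simp add: algebra_simps)
    then show ?thesis unfolding affine_shift_1_iff by blast
  qed
qed

lemma affine_shift_iff:
  "affine_shift 1 \<longleftrightarrow>
    ([CARD('a) = 1] (mod 3) \<and>
      (\<exists>A' a. invertible A' \<and> charpoly A' = monom 1 3 - [:a:] \<and> curve A = curve A')) \<or>
    ((\<exists>e::nat. CARD('a) = 3 ^ e) \<and>
      (\<exists>\<mu> a. \<mu> \<noteq> 0 \<and> charpoly A = monom 1 3 - (smult (\<mu>\<^sup>2) (monom 1 1) + [:a:])))"
  (is "_ \<longleftrightarrow> ?i \<or> ?ii")
proof
  assume "affine_shift 1"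
  then obtain m n where mn: "l 2 = to_ac m * l 1 + to_ac n" unfolding affine_shift_1_iff by blast
  show "?i \<or> ?ii"
  proof (cases "m = 1")
    case True
    then have "l 2 = l 1 + to_ac n" using mn by simp
    then show ?thesis using translation_imp_artin_schreier by blast
  next
    case False
    then show ?thesis using homothety_imp_pure_cubic[OF mn] by blast
  qed
next
  assume "?i \<or> ?ii"
  then show "affine_shift 1"
    using pure_cubic_imp_affine_shift artin_schreier_imp_affine_shift by blast
qed

end

theorem theorem5p4:
  fixes A :: "'a::{field,finite} ^ 3 ^ 3"
  shows "(nonsingular_curve A \<longleftrightarrow> Factorial_Ring.irreducible (charpoly A)) \<and>
    (nonsingular_curve A \<longrightarrow>
      (\<exists>B\<^sub>0 \<in> carrier (Aut_curve A).
        let q = CARD('a); G = Aut_curve A; N = generate G {B\<^sub>0} in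
          \<comment> \<open>(a)\<close>
          subgroup N G \<and> cyclic_group (G\<lparr>carrier := N\<rparr>) \<and> card N = q\<^sup>2 + q + 1 \<and> N \<lhd> G \<and>
          \<comment> \<open>(b)\<close>
          (\<forall>L\<^sub>0 L\<^sub>1 L\<^sub>2 c\<^sub>0 c\<^sub>1 c\<^sub>2.
             eigenvector (transpose (map_matrix to_ac A)) L\<^sub>0 c\<^sub>0 \<and>
             eigenvector (transpose (map_matrix to_ac A)) L\<^sub>1 c\<^sub>1 \<and>
             eigenvector (transpose (map_matrix to_ac A)) L\<^sub>2 c\<^sub>2 \<and>
             c\<^sub>0 \<noteq> c\<^sub>1 \<and> c\<^sub>0 \<noteq> c\<^sub>2 \<and> c\<^sub>1 \<noteq> c\<^sub>2 \<longrightarrow>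
             (\<forall>s::nat. 1 \<le> s \<and> s < q\<^sup>2 + q + 1 \<longrightarrow>
                fixed_points (B\<^sub>0 [^]\<^bsub>G\<^esub> s) = {proj_point L\<^sub>0, proj_point L\<^sub>1, proj_point L\<^sub>2})) \<and>
          \<comment> \<open>(c)\<close>
          (trivial_group (G Mod N) \<or> cyclic_group (G Mod N) \<and> card (carrier (G Mod N)) = 3) \<and>
          \<comment> \<open>(d)\<close>
          (\<not> trivial_group (G Mod N) \<longleftrightarrow>
             ([q = 1] (mod 3) \<and>
              (\<exists>A' a. invertible A' \<and> charpoly A' = monom 1 3 - [:a:] \<and> curve A = curve A')) \<or>
             ((\<exists>e::nat. q = 3 ^ e) \<and>
              (\<exists>\<mu> a. \<mu> \<noteq> 0 \<and> charpoly A = monom 1 3 - (smult (\<mu>\<^sup>2) (monom 1 1) + [:a:]))))))"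
  (is "_ \<and> (_ \<longrightarrow> ?E)")
proof (intro conjI impI)
  show iff: "nonsingular_curve A \<longleftrightarrow> Factorial_Ring.irreducible (charpoly A)"
    by (rule nonsingular_curve_iff_irreducible)
  assume "nonsingular_curve A"
  then obtain l P Q where "frobenius_eigenbasis A l P Q"
    using iff frobenius_eigenbasis_exists by blast
  then interpret frobenius_eigenbasis A l P Q .
  let ?G = "Aut_curve A"
  interpret G: group ?G by (rule group_Aut_curve)
  interpret shift: group_hom ?G Z3 shift_of by (rule shift_of_hom)
  obtain B where B: "proj_class B \<in> carrier ?G"
    and N: "generate ?G {proj_class B} = kernel ?G Z3 shift_of"
    and card: "card (generate ?G {proj_class B}) = CARD('a)\<^sup>2 + CARD('a) + 1"
    and pow: "\<And>s::nat. 1 \<le> s \<Longrightarrow> s < CARD('a)\<^sup>2 + CARD('a) + 1 \<Longrightarrow>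
      \<exists>C d. proj_class B [^]\<^bsub>?G\<^esub> s = proj_class C \<and> hat C = diag d \<and> inj d \<and> (\<forall>i. d i \<noteq> 0)"
    by (rule kernel_generator) blast
  have cyclic: "cyclic_group (?G\<lparr>carrier := generate ?G {proj_class B}\<rparr>)"
    using G.cyclic_group_generated[of "proj_class B"] B
    by (simp add: subgroup_generated_def)
  show ?E
    unfolding Let_def
  proof (intro bexI[OF _ B] conjI allI impI)
    show "subgroup (generate ?G {proj_class B}) ?G" "generate ?G {proj_class B} \<lhd> ?G"
      unfolding N by (rule shift.subgroup_kernel shift.normal_kernel)+
    fix L0 L1 L2 c0 c1 c2 s
    assume L: "eigenvector (transpose (map_matrix to_ac A)) L0 c0 \<and>
        eigenvector (transpose (map_matrix to_ac A)) L1 c1 \<and>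
        eigenvector (transpose (map_matrix to_ac A)) L2 c2 \<and> c0 \<noteq> c1 \<and> c0 \<noteq> c2 \<and> c1 \<noteq> c2"
      and s: "1 \<le> s \<and> s < CARD('a)\<^sup>2 + CARD('a) + 1"
    obtain C d where C: "proj_class B [^]\<^bsub>?G\<^esub> s = proj_class C" "hat C = diag d" "inj d" "\<forall>i. d i \<noteq> 0"
      using pow s by blast
    show "fixed_points (proj_class B [^]\<^bsub>?G\<^esub> s) = {proj_point L0, proj_point L1, proj_point L2}"
      unfolding C(1) using C L by (intro fixed_points_eigenvectors) auto
  next
    show "trivial_group (?G Mod generate ?G {proj_class B}) \<or>
        cyclic_group (?G Mod generate ?G {proj_class B}) \<and>
        card (carrier (?G Mod generate ?G {proj_class B})) = 3"
      unfolding N using quotient_cases by blast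
    show "(\<not> trivial_group (?G Mod generate ?G {proj_class B})) =
         ([CARD('a) = 1] (mod 3) \<and>
              (\<exists>A' a. invertible A' \<and> charpoly A' = monom 1 3 - [:a:] \<and> curve A = curve A') \<or>
             (\<exists>e::nat. CARD('a) = 3 ^ e) \<and>
              (\<exists>\<mu> a. \<mu> \<noteq> 0 \<and> charpoly A = monom 1 3 - (smult (\<mu>\<^sup>2) (monom 1 1) + [:a:])))"
      unfolding N quotient_cases(1) affine_shift_iff[symmetric] by simp
  qed (rule cyclic card)+
qed

end
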